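(* The relation $\mathtt{Sat}_{\Delta_0}(x,y)$ on $\mathbb{N}$ is primitive recursive.
   Context: $\mathbb{N}$ contains $0$ and also denotes the standard model of arithmetic. A relation $R\subseteq\mathbb{N}^n$ is primitive recursive if its characteristic function $\chi_R\colon\mathbb{N}^n\to\{0,1\}$ (equal to $1$ exactly on $R$) is a primitive recursive function, i.e. belongs to the smallest class of functions containing the constant zero function, the successor function and the projections, and closed under composition and primitive recursion. Formulas are first-order formulas in the language $\langle 0,1,+,\times,\leqslant\rangle$ with equality and variables $v_0,v_1,v_2,\ldots$. Bounded formulas. A formula is bounded (a $\Delta_0$-formula) if it is constructed from atomic formulas $t=s$, $t\leqslant s$ ($t,s$ terms) by means of negation, conjunction, disjunction, implication and bounded quantifications $\forall x\leqslant t$, $\exists x\leqslant t$, where $t$ is a term in which the variable $x$ does not occur; $\forall x\leqslant t\,\mathcal{A}$ abbreviates $\forall x[x\leqslant t\rightarrow\mathcal{A}]$ and $\exists x\leqslant t\,\mathcal{A}$ abbreviates $\exists x[x\leqslant t\wedge\mathcal{A}]$. Gödel coding. Fix a Gödel coding $\alpha\mapsto\ulcorner\alpha\urcorner\in\mathbb{N}$ of terms and formulas which is primitive recursive in the usual sense: it is injective; the set of codes of variables is primitive recursive and the passages from $i$ to $\ulcorner v_i\urcorner$ and back are primitive recursive; the codes of $t+s$, $t\times s$, $t=s$, $t\leqslant s$, $\neg A$, $A\wedge B$, $A\vee B$, $A\rightarrow B$, $\forall x\leqslant t\,A$, $\exists x\leqslant t\,A$ are given by primitive recursive functions of the codes of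 the constituents (terms $t,s$, formulas $A,B$, variable $x$), and are strictly greater than the codes of these constituents. Satisfaction. $\mathtt{Sat}_{\Delta_0}$ is the set of all ordered pairs $(\ulcorner\theta(\vec\nu)\urcorner,a)$ where $\theta(\vec\nu)$ is a $\Delta_0$-formula with free variables $\vec\nu$, $a\in\mathbb{N}$, and $\mathbb{N}\models\theta(\vec a)$, i.e. the sentence resulting from substituting (the numeral of) the single number $a$ for every free variable of $\theta$ is true in $\mathbb{N}$. *)

theory Defs
  imports Main
begin

text \<open>A function \<open>\<nat>\<^sup>n \<rightarrow> \<nat>\<close> is represented by a function on lists, of which only the
  values on lists of length \<open>n\<close> matter; the last rule identifies functions that agree on these
  lists. In the recursion rule, the recursion variable is the first argument.\<close>

inductive primitive_recursive :: "nat \<Rightarrow> (nat list \<Rightarrow> nat) \<Rightarrow> bool" where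
  zero: "primitive_recursive n (\<lambda>_. 0)"
| suc: "primitive_recursive 1 (\<lambda>xs. Suc (xs ! 0))"
| proj: "i < n \<Longrightarrow> primitive_recursive n (\<lambda>xs. xs ! i)"
| comp: "primitive_recursive (length gs) h \<Longrightarrow> \<forall>g \<in> set gs. primitive_recursive n g \<Longrightarrow>
    primitive_recursive n (\<lambda>xs. h (map (\<lambda>g. g xs) gs))"
| prec: "primitive_recursive n g \<Longrightarrow> primitive_recursive (n + 2) h \<Longrightarrow>
    primitive_recursive (n + 1)
      (\<lambda>xs. rec_nat (g (tl xs)) (\<lambda>k r. h (k # r # tl xs)) (hd xs))"
| ext: "primitive_recursive n f \<Longrightarrow> (\<forall>xs. length xs = n \<longrightarrow> f xs = g xs) \<Longrightarrow>
    primitive_recursive n g"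

definition primitive_recursive_rel :: "nat \<Rightarrow> nat list set \<Rightarrow> bool" where
  "primitive_recursive_rel n R \<longleftrightarrow>
     R \<subseteq> {xs. length xs = n} \<and> primitive_recursive n (\<lambda>xs. if xs \<in> R then 1 else 0)"

datatype trm = Var nat | Zero | One | Add trm trm | Mul trm trm

datatype fml = Eq trm trm | Le trm trm
  | Neg fml | And fml fml | Or fml fml | Imp fml fml
  | All nat fml | Ex nat fml

fun vars_trm :: "trm \<Rightarrow> nat set" where
  "vars_trm (Var i) = {i}"
| "vars_trm Zero = {}"
| "vars_trm One = {}"
| "vars_trm (Add t s) = vars_trm t \<union> vars_trm s"
| "vars_trm (Mul t s) = vars_trm t \<union> vars_trm s"

abbreviation BAll :: "nat \<Rightarrow> trm \<Rightarrow> fml \<Rightarrow> fml" where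
  "BAll x t A \<equiv> All x (Imp (Le (Var x) t) A)"

abbreviation BEx :: "nat \<Rightarrow> trm \<Rightarrow> fml \<Rightarrow> fml" where
  "BEx x t A \<equiv> Ex x (And (Le (Var x) t) A)"

inductive Delta0 :: "fml \<Rightarrow> bool" where
  "Delta0 (Eq t s)"
| "Delta0 (Le t s)"
| "Delta0 A \<Longrightarrow> Delta0 (Neg A)"
| "Delta0 A \<Longrightarrow> Delta0 B \<Longrightarrow> Delta0 (And A B)"
| "Delta0 A \<Longrightarrow> Delta0 B \<Longrightarrow> Delta0 (Or A B)"
| "Delta0 A \<Longrightarrow> Delta0 B \<Longrightarrow> Delta0 (Imp A B)"
| "x \<notin> vars_trm t \<Longrightarrow> Delta0 A \<Longrightarrow> Delta0 (BAll x t A)"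
| "x \<notin> vars_trm t \<Longrightarrow> Delta0 A \<Longrightarrow> Delta0 (BEx x t A)"

fun val :: "(nat \<Rightarrow> nat) \<Rightarrow> trm \<Rightarrow> nat" where
  "val e (Var i) = e i"
| "val e Zero = 0"
| "val e One = 1"
| "val e (Add t s) = val e t + val e s"
| "val e (Mul t s) = val e t * val e s"

fun holds :: "(nat \<Rightarrow> nat) \<Rightarrow> fml \<Rightarrow> bool" where
  "holds e (Eq t s) \<longleftrightarrow> val e t = val e s"
| "holds e (Le t s) \<longleftrightarrow> val e t \<le> val e s"
| "holds e (Neg A) \<longleftrightarrow> \<not> holds e A"
| "holds e (And A B) \<longleftrightarrow> holds e A \<and> holds e B"
| "holds e (Or A B) \<longleftrightarrow> holds e A \<or> holds e B"
| "holds e (Imp A B) \<longleftrightarrow> (holds e A \<longrightarrow> holds e B)"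
| "holds e (All x A) \<longleftrightarrow> (\<forall>n. holds (e(x := n)) A)"
| "holds e (Ex x A) \<longleftrightarrow> (\<exists>n. holds (e(x := n)) A)"

text \<open>Truth in the standard model; applied below to sentences only, whose truth does not depend
  on the assignment.\<close>

definition N_models :: "fml \<Rightarrow> bool" where
  "N_models A \<longleftrightarrow> (\<forall>e. holds e A)"

fun subst_trm :: "(nat \<Rightarrow> trm) \<Rightarrow> trm \<Rightarrow> trm" where
  "subst_trm \<sigma> (Var i) = \<sigma> i"
| "subst_trm \<sigma> Zero = Zero"
| "subst_trm \<sigma> One = One"
| "subst_trm \<sigma> (Add t s) = Add (subst_trm \<sigma> t) (subst_trm \<sigma> s)"
| "subst_trm \<sigma> (Mul t s) = Mul (subst_trm \<sigma> t) (subst_trm \<sigma> s)"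

text \<open>Simultaneous substitution for the free variables. Bound variables are not renamed, so this
  is meant for \<open>\<sigma>\<close> with closed values, such as numerals, where no variable can be captured.\<close>

fun subst_fml :: "(nat \<Rightarrow> trm) \<Rightarrow> fml \<Rightarrow> fml" where
  "subst_fml \<sigma> (Eq t s) = Eq (subst_trm \<sigma> t) (subst_trm \<sigma> s)"
| "subst_fml \<sigma> (Le t s) = Le (subst_trm \<sigma> t) (subst_trm \<sigma> s)"
| "subst_fml \<sigma> (Neg A) = Neg (subst_fml \<sigma> A)"
| "subst_fml \<sigma> (And A B) = And (subst_fml \<sigma> A) (subst_fml \<sigma> B)"
| "subst_fml \<sigma> (Or A B) = Or (subst_fml \<sigma> A) (subst_fml \<sigma> B)"
| "subst_fml \<sigma> (Imp A B) = Imp (subst_fml \<sigma> A) (subst_fml \<sigma> B)"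
| "subst_fml \<sigma> (All x A) = All x (subst_fml (\<sigma>(x := Var x)) A)"
| "subst_fml \<sigma> (Ex x A) = Ex x (subst_fml (\<sigma>(x := Var x)) A)"

fun num :: "nat \<Rightarrow> trm" where
  "num 0 = Zero"
| "num (Suc n) = Add (num n) One"

text \<open>A coding of terms and formulas is given by its restrictions to the two sorts; it is injective
  on their disjoint union. A variable \<open>v\<^sub>i\<close> is coded as the term \<open>Var i\<close>. The
  bounded quantifiers are only considered when the variable does not occur in the bound.\<close>

locale goedel_coding =
  fixes code_trm :: "trm \<Rightarrow> nat" and code_fml :: "fml \<Rightarrow> nat"
  assumes inj_code: "inj (case_sum code_trm code_fml)"
    and pr_var_codes: "primitive_recursive_rel 1 {[code_trm (Var i)] | i. True}"
    and pr_var: "primitive_recursive 1 (\<lambda>xs. code_trm (Var (xs ! 0)))"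
    and pr_var_index: "\<exists>f. primitive_recursive 1 f \<and> (\<forall>i. f [code_trm (Var i)] = i)"
    and pr_Add: "\<exists>f. primitive_recursive 2 f \<and>
      (\<forall>t s. code_trm (Add t s) = f [code_trm t, code_trm s])"
    and pr_Mul: "\<exists>f. primitive_recursive 2 f \<and>
      (\<forall>t s. code_trm (Mul t s) = f [code_trm t, code_trm s])"
    and pr_Eq: "\<exists>f. primitive_recursive 2 f \<and>
      (\<forall>t s. code_fml (Eq t s) = f [code_trm t, code_trm s])"
    and pr_Le: "\<exists>f. primitive_recursive 2 f \<and>
      (\<forall>t s. code_fml (Le t s) = f [code_trm t, code_trm s])"
    and pr_Neg: "\<exists>f. primitive_recursive 1 f \<and> (\<forall>A. code_fml (Neg A) = f [code_fml A])"
    and pr_And: "\<exists>f. primitive_recursive 2 f \<and>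
      (\<forall>A B. code_fml (And A B) = f [code_fml A, code_fml B])"
    and pr_Or: "\<exists>f. primitive_recursive 2 f \<and>
      (\<forall>A B. code_fml (Or A B) = f [code_fml A, code_fml B])"
    and pr_Imp: "\<exists>f. primitive_recursive 2 f \<and>
      (\<forall>A B. code_fml (Imp A B) = f [code_fml A, code_fml B])"
    and pr_BAll: "\<exists>f. primitive_recursive 3 f \<and>
      (\<forall>x t A. x \<notin> vars_trm t \<longrightarrow>
        code_fml (BAll x t A) = f [code_trm (Var x), code_trm t, code_fml A])"
    and pr_BEx: "\<exists>f. primitive_recursive 3 f \<and>
      (\<forall>x t A. x \<notin> vars_trm t \<longrightarrow>
        code_fml (BEx x t A) = f [code_trm (Var x), code_trm t, code_fml A])"
    and less_Add: "code_trm t < code_trm (Add t s)" "code_trm s < code_trm (Add t s)"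
    and less_Mul: "code_trm t < code_trm (Mul t s)" "code_trm s < code_trm (Mul t s)"
    and less_Eq: "code_trm t < code_fml (Eq t s)" "code_trm s < code_fml (Eq t s)"
    and less_Le: "code_trm t < code_fml (Le t s)" "code_trm s < code_fml (Le t s)"
    and less_Neg: "code_fml A < code_fml (Neg A)"
    and less_And: "code_fml A < code_fml (And A B)" "code_fml B < code_fml (And A B)"
    and less_Or: "code_fml A < code_fml (Or A B)" "code_fml B < code_fml (Or A B)"
    and less_Imp: "code_fml A < code_fml (Imp A B)" "code_fml B < code_fml (Imp A B)"
    and less_BAll: "x \<notin> vars_trm t \<Longrightarrow> code_trm (Var x) < code_fml (BAll x t A)"
      "x \<notin> vars_trm t \<Longrightarrow> code_trm t < code_fml (BAll x t A)"
      "x \<notin> vars_trm t \<Longrightarrow> code_fml A < code_fml (BAll x t A)"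
    and less_BEx: "x \<notin> vars_trm t \<Longrightarrow> code_trm (Var x) < code_fml (BEx x t A)"
      "x \<notin> vars_trm t \<Longrightarrow> code_trm t < code_fml (BEx x t A)"
      "x \<notin> vars_trm t \<Longrightarrow> code_fml A < code_fml (BEx x t A)"

definition Sat_Delta0 :: "(fml \<Rightarrow> nat) \<Rightarrow> (nat \<times> nat) set" where
  "Sat_Delta0 code_fml =
     {(code_fml \<theta>, a) | \<theta> a. Delta0 \<theta> \<and> N_models (subst_fml (\<lambda>_. num a) \<theta>)}"

end

theory Submission
  imports Defs
begin

text \<open>A term or bounded formula with code \<open>x\<close> has finitely many variables, and its evaluation at
  \<open>a\<close> only meets values below a primitive recursive bound \<open>D x a\<close>. Assignments of values below
  \<open>D\<close> to the first \<open>K\<close> variables are coded by their digits in base \<open>D\<close>, so a bounded quantifier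
  becomes a search through the numbers below \<open>D ^ K\<close>. The value of the expression with code
  \<open>y\<close> at the assignment \<open>\<epsilon> < D ^ K\<close> depends only on the values of expressions with smaller
  codes. It is therefore computed by course-of-values recursion on \<open>y * D ^ K + \<epsilon>\<close>, which is the
  lexicographic position of \<open>(y, \<epsilon>)\<close>; the recursion never changes a parameter.\<close>

subsection \<open>Closure properties of primitive recursive functions\<close>

abbreviation primitive_recursive_pred :: "nat \<Rightarrow> (nat list \<Rightarrow> bool) \<Rightarrow> bool" where
  "primitive_recursive_pred n P \<equiv> primitive_recursive n (\<lambda>xs. of_bool (P xs))"

named_theorems pr_intros

lemma pr_cong:
  assumes "primitive_recursive n f" "\<And>xs. length xs = n \<Longrightarrow> f xs = g xs"
  shows "primitive_recursive n g"
  using primitive_recursive.ext assms by blast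

lemma pr_comp1:
  assumes "primitive_recursive 1 (\<lambda>xs. h (xs ! 0))" "primitive_recursive n f"
  shows "primitive_recursive n (\<lambda>xs. h (f xs))"
  using primitive_recursive.comp[of "[f]" "\<lambda>xs. h (xs ! 0)" n] assms by simp

lemma pr_comp2:
  assumes "primitive_recursive 2 (\<lambda>xs. h (xs ! 0) (xs ! 1))"
    "primitive_recursive n f" "primitive_recursive n g"
  shows "primitive_recursive n (\<lambda>xs. h (f xs) (g xs))"
  using primitive_recursive.comp[of "[f, g]" "\<lambda>xs. h (xs ! 0) (xs ! 1)" n] assms
  by (simp add: numeral_2_eq_2)

lemma pr_comp3:
  assumes "primitive_recursive 3 (\<lambda>xs. h (xs ! 0) (xs ! 1) (xs ! 2))"
    "primitive_recursive n f" "primitive_recursive n g" "primitive_recursive n k"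
  shows "primitive_recursive n (\<lambda>xs. h (f xs) (g xs) (k xs))"
  using primitive_recursive.comp[of "[f, g, k]" "\<lambda>xs. h (xs ! 0) (xs ! 1) (xs ! 2)" n] assms
  by (simp add: numeral_3_eq_3 numeral_2_eq_2)

lemma pr_comp4:
  assumes "primitive_recursive 4 (\<lambda>xs. h (xs ! 0) (xs ! 1) (xs ! 2) (xs ! 3))"
    "primitive_recursive n f" "primitive_recursive n g" "primitive_recursive n k"
    "primitive_recursive n l"
  shows "primitive_recursive n (\<lambda>xs. h (f xs) (g xs) (k xs) (l xs))"
  using primitive_recursive.comp[of "[f, g, k, l]"
    "\<lambda>xs. h (xs ! 0) (xs ! 1) (xs ! 2) (xs ! 3)" n] assms
  by (simp add: eval_nat_numeral)

lemma pr_nth [pr_intros]: "i < n \<Longrightarrow> primitive_recursive n (\<lambda>xs. xs ! i)"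
  by (rule primitive_recursive.proj)

lemma pr_Suc [pr_intros]:
  "primitive_recursive n f \<Longrightarrow> primitive_recursive n (\<lambda>xs. Suc (f xs))"
  using pr_comp1[OF primitive_recursive.suc] .

lemma pr_const [pr_intros]: "primitive_recursive n (\<lambda>_. c)"
  by (induction c) (auto intro: primitive_recursive.zero pr_Suc)

text \<open>Composition with projections, packaged as a change of argument list: the first
  \<open>j\<close> arguments give way to computed ones. Deleting, inserting and regrouping leading
  arguments are instances.\<close>

lemma pr_append_drop:
  assumes "primitive_recursive (length bs + n) h" "\<forall>b \<in> set bs. primitive_recursive (j + n) b"
  shows "primitive_recursive (j + n) (\<lambda>xs. h (map (\<lambda>b. b xs) bs @ drop j xs))"
proof -
  let ?gs = "bs @ map (\<lambda>i xs. xs ! (j + i)) [0..<n]"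
  have "primitive_recursive (j + n) (\<lambda>xs. h (map (\<lambda>g. g xs) ?gs))"
    using assms by (intro primitive_recursive.comp) (auto intro: primitive_recursive.proj)
  then show ?thesis
  proof (rule pr_cong)
    fix xs :: "nat list" assume "length xs = j + n"
    then have "map (\<lambda>g. g xs) ?gs = map (\<lambda>b. b xs) bs @ drop j xs"
      by (auto intro: nth_equalityI)
    then show "h (map (\<lambda>g. g xs) ?gs) = h (map (\<lambda>b. b xs) bs @ drop j xs)" by simp
  qed
qed

lemma pr_tl: "primitive_recursive n f \<Longrightarrow> primitive_recursive (Suc n) (\<lambda>xs. f (tl xs))"
  using pr_append_drop[of "[]" n f 1] by (simp add: drop_Suc)

lemma pr_Cons:
  assumes "primitive_recursive (Suc n) h" "primitive_recursive n b"
  shows "primitive_recursive n (\<lambda>xs. h (b xs # xs))"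
  using pr_append_drop[of "[b]" n h 0] assms by simp

lemma pr_hd [pr_intros]: "primitive_recursive (Suc n) hd"
  by (rule pr_cong[OF primitive_recursive.proj[of 0]]) (auto simp: length_Suc_conv)

text \<open>A bounded sum or quantifier puts its variable in front of the argument list, so under
  nested binders the outer arguments sit behind several tails.\<close>

lemmas pr_hd_tl [pr_intros] =
  pr_hd[THEN pr_tl] pr_hd[THEN pr_tl, THEN pr_tl] pr_hd[THEN pr_tl, THEN pr_tl, THEN pr_tl]
  pr_hd[THEN pr_tl, THEN pr_tl, THEN pr_tl, THEN pr_tl]

lemmas pr_nth_tl [pr_intros] =
  pr_nth[THEN pr_tl] pr_nth[THEN pr_tl, THEN pr_tl] pr_nth[THEN pr_tl, THEN pr_tl, THEN pr_tl]
  pr_nth[THEN pr_tl, THEN pr_tl, THEN pr_tl, THEN pr_tl]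
  pr_nth[THEN pr_tl, THEN pr_tl, THEN pr_tl, THEN pr_tl, THEN pr_tl]

text \<open>In \<open>prec\<close> the number of iterations is a separate first argument;
  \<open>pr_Cons\<close> supplies it as a function of the parameters.\<close>

lemma pr_rec:
  assumes "primitive_recursive n b" "primitive_recursive n g"
    "primitive_recursive (Suc (Suc n)) (\<lambda>ys. h (hd ys) (hd (tl ys)) (tl (tl ys)))"
  shows "primitive_recursive n (\<lambda>xs. rec_nat (g xs) (\<lambda>k r. h k r xs) (b xs))"
  using pr_Cons[OF primitive_recursive.prec[of n g "\<lambda>ys. h (hd ys) (hd (tl ys)) (tl (tl ys))",
    simplified] assms(1)] assms by simp

lemma pr_add [pr_intros]:
  assumes "primitive_recursive n f" "primitive_recursive n g"
  shows "primitive_recursive n (\<lambda>xs. f xs + g xs)"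
proof -
  have "rec_nat a (\<lambda>_ r. Suc r) b = b + a" for a b by (induction b) auto
  then show ?thesis
    using pr_rec[of n f g "\<lambda>_ r _. Suc r"] assms by (simp add: pr_intros)
qed

lemma pr_mult [pr_intros]:
  assumes "primitive_recursive n f" "primitive_recursive n g"
  shows "primitive_recursive n (\<lambda>xs. f xs * g xs)"
proof -
  have "rec_nat 0 (\<lambda>_ r. r + a) b = b * a" for a b :: nat by (induction b) auto
  moreover have "primitive_recursive (Suc (Suc n)) (\<lambda>ys. hd (tl ys) + g (tl (tl ys)))"
    by (intro pr_intros pr_tl assms)
  ultimately show ?thesis
    using pr_rec[of n f "\<lambda>_. 0" "\<lambda>_ r xs. r + g xs"] assms by (simp add: pr_intros)
qed

lemma pr_power [pr_intros]:
  assumes "primitive_recursive n f" "primitive_recursive n g"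
  shows "primitive_recursive n (\<lambda>xs. f xs ^ g xs)"
proof -
  have "rec_nat 1 (\<lambda>_ r. r * a) b = a ^ b" for a b :: nat by (induction b) auto
  moreover have "primitive_recursive (Suc (Suc n)) (\<lambda>ys. hd (tl ys) * f (tl (tl ys)))"
    by (intro pr_intros pr_tl assms)
  ultimately show ?thesis
    using pr_rec[of n g "\<lambda>_. 1" "\<lambda>_ r xs. r * f xs"] assms by (simp add: pr_intros)
qed

lemma pr_pred:
  assumes "primitive_recursive n f"
  shows "primitive_recursive n (\<lambda>xs. f xs - 1)"
proof -
  have "rec_nat 0 (\<lambda>k _. k) b = b - 1" for b by (induction b) auto
  then show ?thesis
    using pr_rec[of n f "\<lambda>_. 0" "\<lambda>k _ _. k"] assms by (simp add: pr_intros)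
qed

lemma pr_diff [pr_intros]:
  assumes "primitive_recursive n f" "primitive_recursive n g"
  shows "primitive_recursive n (\<lambda>xs. f xs - g xs)"
proof -
  have "rec_nat a (\<lambda>_ r. r - 1) b = a - b" for a b :: nat by (induction b) auto
  moreover have "primitive_recursive (Suc (Suc n)) (\<lambda>ys. hd (tl ys) - 1)"
    by (intro pr_intros pr_pred)
  ultimately show ?thesis
    using pr_rec[of n g f "\<lambda>_ r _. r - 1"] assms by simp
qed

lemma pr_sum [pr_intros]:
  assumes "primitive_recursive n b" "primitive_recursive (Suc n) (\<lambda>ys. f (hd ys) (tl ys))"
  shows "primitive_recursive n (\<lambda>xs. \<Sum>k<b xs. f k xs)"
proof -
  have "rec_nat 0 (\<lambda>k r. r + g k) m = (\<Sum>k<m. g k)" for g :: "nat \<Rightarrow> nat" and m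
    by (induction m) auto
  \<comment> \<open>The recursion step receives the partial sum as second argument; it is dropped
    before the summand is applied.\<close>
  moreover have "primitive_recursive (Suc (Suc n)) (\<lambda>ys. hd (tl ys) + f (hd ys) (tl (tl ys)))"
    using pr_append_drop[of "[hd]" n "\<lambda>ys. f (hd ys) (tl ys)" 2] assms(2)
    by (intro pr_intros) (simp_all add: pr_intros drop_Suc numeral_2_eq_2)
  ultimately show ?thesis
    using pr_rec[of n b "\<lambda>_. 0" "\<lambda>k r xs. r + f k xs"] assms by (simp add: pr_intros)
qed

lemma pr_not [pr_intros]:
  assumes "primitive_recursive_pred n P"
  shows "primitive_recursive_pred n (\<lambda>xs. \<not> P xs)"
proof -
  have "primitive_recursive n (\<lambda>xs. 1 - of_bool (P xs))"
    by (intro pr_intros assms)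
  then show ?thesis by (rule pr_cong) simp
qed

lemma pr_conj [pr_intros]:
  assumes "primitive_recursive_pred n P" "primitive_recursive_pred n Q"
  shows "primitive_recursive_pred n (\<lambda>xs. P xs \<and> Q xs)"
  unfolding of_bool_conj by (intro pr_intros assms)

lemma pr_disj [pr_intros]:
  assumes "primitive_recursive_pred n P" "primitive_recursive_pred n Q"
  shows "primitive_recursive_pred n (\<lambda>xs. P xs \<or> Q xs)"
proof -
  have "primitive_recursive_pred n (\<lambda>xs. \<not> (\<not> P xs \<and> \<not> Q xs))"
    by (intro pr_intros assms)
  then show ?thesis by simp
qed

lemma pr_imp [pr_intros]:
  assumes "primitive_recursive_pred n P" "primitive_recursive_pred n Q"
  shows "primitive_recursive_pred n (\<lambda>xs. P xs \<longrightarrow> Q xs)"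
  unfolding imp_conv_disj by (intro pr_intros assms)

lemma pr_le [pr_intros]:
  assumes "primitive_recursive n f" "primitive_recursive n g"
  shows "primitive_recursive_pred n (\<lambda>xs. f xs \<le> g xs)"
proof -
  have "primitive_recursive n (\<lambda>xs. 1 - (f xs - g xs))"
    by (intro pr_intros assms)
  then show ?thesis by (rule pr_cong) simp
qed

lemma pr_eq [pr_intros]:
  assumes "primitive_recursive n f" "primitive_recursive n g"
  shows "primitive_recursive_pred n (\<lambda>xs. f xs = g xs)"
  unfolding order.eq_iff by (intro pr_intros assms)

lemma pr_if [pr_intros]:
  assumes "primitive_recursive_pred n P" "primitive_recursive n f" "primitive_recursive n g"
  shows "primitive_recursive n (\<lambda>xs. if P xs then f xs else g xs)"
proof -
  have "primitive_recursive n (\<lambda>xs. of_bool (P xs) * f xs + of_bool (\<not> P xs) * g xs)"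
    by (intro pr_intros assms)
  then show ?thesis by (rule pr_cong) simp
qed

lemma pr_bex [pr_intros]:
  assumes "primitive_recursive n b" "primitive_recursive_pred (Suc n) (\<lambda>ys. P (hd ys) (tl ys))"
  shows "primitive_recursive_pred n (\<lambda>xs. \<exists>k<b xs. P k xs)"
proof -
  have "primitive_recursive_pred n (\<lambda>xs. \<not> (\<Sum>k<b xs. of_bool (P k xs)) = (0::nat))"
    by (intro pr_intros assms)
  then show ?thesis by (rule pr_cong) auto
qed

lemma pr_ball [pr_intros]:
  assumes "primitive_recursive n b" "primitive_recursive_pred (Suc n) (\<lambda>ys. P (hd ys) (tl ys))"
  shows "primitive_recursive_pred n (\<lambda>xs. \<forall>k<b xs. P k xs)"
proof -
  have "primitive_recursive_pred n (\<lambda>xs. \<not> (\<exists>k<b xs. \<not> P k xs))"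
    by (intro pr_intros assms)
  then show ?thesis by simp
qed

text \<open>For \<open>b > 0\<close> the quotient counts the positive multiples of \<open>b\<close>
  up to \<open>a\<close>, all of which are among the first \<open>a\<close> multiples. For
  \<open>b = 0\<close> every summand would be 1, hence the case distinction.\<close>

lemma pr_div [pr_intros]:
  assumes "primitive_recursive n f" "primitive_recursive n g"
  shows "primitive_recursive n (\<lambda>xs. f xs div g xs)"
proof -
  have "primitive_recursive n
      (\<lambda>xs. if g xs = 0 then 0 else \<Sum>k<f xs. of_bool (Suc k * g xs \<le> f xs))"
    by (intro pr_intros assms pr_tl)
  moreover have "(\<Sum>k<a. of_bool (Suc k * b \<le> a)) = a div b" if "b \<noteq> 0" for a b :: nat
  proof -
    have "(\<Sum>k<a. of_bool (Suc k * b \<le> a)) = card {k. k < a \<and> Suc k * b \<le> a}"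
      by (simp add: of_bool_def sum.If_cases Int_def)
    also have "{k. k < a \<and> Suc k * b \<le> a} = {..<a div b}"
    proof (rule set_eqI)
      fix k
      have "Suc k * b \<le> a \<longleftrightarrow> k < a div b"
        using that by (simp add: less_eq_div_iff_mult_less_eq Suc_le_eq[symmetric] del: mult_Suc)
      moreover have "k < a" if "k < a div b"
        using that div_le_dividend[of a b] by linarith
      ultimately show "k \<in> {k. k < a \<and> Suc k * b \<le> a} \<longleftrightarrow> k \<in> {..<a div b}" by auto
    qed
    finally show ?thesis by simp
  qed
  ultimately show ?thesis
    by (elim pr_cong) auto
qed

lemma pr_mod [pr_intros]:
  assumes "primitive_recursive n f" "primitive_recursive n g"
  shows "primitive_recursive n (\<lambda>xs. f xs mod g xs)"
  unfolding minus_div_mult_eq_mod[symmetric] by (intro pr_intros assms)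

subsection \<open>Course-of-values recursion\<close>

text \<open>Sequences with entries below \<open>b\<close> are stored as numbers in base
  \<open>b\<close>, because decoding then takes only a power, a quotient and a remainder.\<close>

definition digit :: "nat \<Rightarrow> nat \<Rightarrow> nat \<Rightarrow> nat" where
  "digit b m i = m div b ^ i mod b"

lemma pr_digit [pr_intros]:
  assumes "primitive_recursive n f" "primitive_recursive n g" "primitive_recursive n h"
  shows "primitive_recursive n (\<lambda>xs. digit (f xs) (g xs) (h xs))"
  unfolding digit_def by (intro pr_intros assms)

lemma sum_digits_less:
  assumes "\<And>k. k < p \<Longrightarrow> f k < b"
  shows "(\<Sum>k<p. f k * b ^ k) < (b::nat) ^ p"
  using assms
proof (induction p)
  case (Suc p)
  have "(\<Sum>k<p. f k * b ^ k) < b ^ p" "Suc (f p) * b ^ p \<le> b * b ^ p"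
    using Suc by (auto intro!: mult_right_mono simp: Suc_le_eq simp del: mult_Suc)
  then show ?case by simp
qed simp

text \<open>Induction adds a new top digit. At its own position the rest is too small to matter; at
  a lower position \<open>k\<close> it contributes a multiple of \<open>b ^ Suc k\<close>, which the
  remainder removes.\<close>

lemma digit_sum:
  assumes "\<And>k. k < p \<Longrightarrow> f k < b" "k < p"
  shows "digit b (\<Sum>k<p. f k * b ^ k) k = f k"
  using assms
proof (induction p)
  case (Suc p)
  have b: "b > 0" using Suc.prems(1)[of 0] by simp
  let ?s = "\<Sum>k<p. f k * b ^ k"
  show ?case
  proof (cases "k = p")
    case True
    have "?s < b ^ p" using Suc.prems by (intro sum_digits_less) auto
    then show ?thesis using True b Suc.prems(1)[of p] by (simp add: digit_def)
  next
    case False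
    then obtain j where j: "p = k + Suc j"
      using Suc.prems(2) less_imp_Suc_add[of k p] by fastforce
    have "b ^ p = b ^ j * b * b ^ k" unfolding j by (simp add: power_add)
    then have "?s + f p * b ^ p = ?s + (f p * b ^ j * b) * b ^ k" by simp
    then have "(?s + f p * b ^ p) div b ^ k = ?s div b ^ k + f p * b ^ j * b"
      using b by (simp only: div_mult_self1) simp
    then show ?thesis using False Suc by (simp add: digit_def)
  qed
qed simp

text \<open>The history of \<open>F\<close> below \<open>y\<close> is the number \<open>H\<close> with the digits
  \<open>F 0 xs, \<dots>, F (y - 1) xs\<close> in base \<open>D xs\<close>.\<close>

lemma course_of_values:
  assumes G: "primitive_recursive (n + 2) G" and D: "primitive_recursive n D"
  obtains F where "primitive_recursive (n + 1) (\<lambda>xs. F (hd xs) (tl xs))"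
    "\<And>y xs. \<lbrakk>length xs = n; 0 < D xs\<rbrakk> \<Longrightarrow>
      \<exists>H. F y xs = G (y # H # xs) mod D xs \<and> (\<forall>z<y. digit (D xs) H z = F z xs)"
proof -
  \<comment> \<open>The remainder modulo \<open>D xs\<close> makes each value a legal digit, so a
    value is appended to the history by adding it times a power of the base.\<close>
  define hist where "hist y xs =
    rec_nat 0 (\<lambda>k r. r + (G (k # r # xs) mod D xs) * D xs ^ k) y" for y xs
  define F where "F y xs = G (y # hist y xs # xs) mod D xs" for y xs
  have G': "primitive_recursive (Suc (Suc n)) G" using G by simp
  have "primitive_recursive (n + 2) (\<lambda>ys. hd (tl ys) + (G ys mod D (tl (tl ys))) * D (tl (tl ys)) ^ hd ys)"
    unfolding add_2_eq_Suc' by (intro pr_intros pr_tl D G')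
  from primitive_recursive.prec[OF primitive_recursive.zero this]
  have hist: "primitive_recursive (Suc n) (\<lambda>xs. hist (hd xs) (tl xs))"
    by (simp add: hist_def)
  have "primitive_recursive (Suc n) (\<lambda>xs. G (hd xs # hist (hd xs) (tl xs) # tl xs))"
    using pr_append_drop[of "[hd, \<lambda>xs. hist (hd xs) (tl xs)]" n G 1] G hist
    by (simp add: pr_intros drop_Suc)
  then have "primitive_recursive (n + 1) (\<lambda>xs. F (hd xs) (tl xs))"
    using D by (simp add: F_def pr_intros pr_tl)
  moreover have "\<exists>H. F y xs = G (y # H # xs) mod D xs \<and> (\<forall>z<y. digit (D xs) H z = F z xs)"
    if "0 < D xs" for y xs
  proof (intro exI conjI allI impI)
    show "F y xs = G (y # hist y xs # xs) mod D xs" by (simp add: F_def)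
    have "hist y xs = (\<Sum>k<y. F k xs * D xs ^ k)"
      by (induction y) (auto simp: hist_def F_def)
    then show "digit (D xs) (hist y xs) z = F z xs" if "z < y" for z
      using that \<open>0 < D xs\<close> digit_sum[of y "\<lambda>k. F k xs" "D xs"] by (simp add: F_def)
  qed
  ultimately show ?thesis using that by blast
qed

text \<open>Truth values are digits in base 2. By strong induction the recursively computed function
  agrees with \<open>R\<close>, as \<open>P\<close> computes \<open>R\<close> from any history that
  is correct below \<open>y\<close>.\<close>

lemma course_of_values_pred:
  assumes P: "primitive_recursive_pred (n + 2) P"
    and R: "\<And>y H xs. \<lbrakk>length xs = n; \<And>z. z < y \<Longrightarrow> digit 2 H z = of_bool (R z xs)\<rbrakk> \<Longrightarrow>
      P (y # H # xs) = R y xs"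
  shows "primitive_recursive_pred (n + 1) (\<lambda>xs. R (hd xs) (tl xs))"
proof -
  obtain F where F: "primitive_recursive (n + 1) (\<lambda>xs. F (hd xs) (tl xs))"
    and FH: "\<And>y xs. length xs = n \<Longrightarrow> \<exists>H. F y xs = of_bool (P (y # H # xs)) mod 2 \<and>
      (\<forall>z<y. digit 2 H z = F z xs)"
    using course_of_values[OF P pr_const[of n 2]] by auto
  have "F y xs = of_bool (R y xs)" if len: "length xs = n" for y xs
  proof (induction y rule: less_induct)
    case (less y)
    obtain H where "F y xs = of_bool (P (y # H # xs)) mod 2" "\<forall>z<y. digit 2 H z = F z xs"
      using FH[OF len, of y] by blast
    then show ?case using R[of xs y H] len less by simp
  qed
  then show ?thesis using F by (elim pr_cong) simp
qed


subsection \<open>Truth and assignments\<close>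

lemma val_cong: "(\<And>i. i \<in> vars_trm t \<Longrightarrow> e i = e' i) \<Longrightarrow> val e t = val e' t"
  by (induction t) auto

lemma val_subst_trm: "val e (subst_trm \<sigma> t) = val (\<lambda>i. val e (\<sigma> i)) t"
  by (induction t) auto

text \<open>The hypothesis admits closed terms for free variables and \<open>Var x\<close> for a
  bound \<open>x\<close>, so it survives passing under a quantifier; it excludes capture because
  \<open>x\<close> can only occur in the value at \<open>x\<close>.\<close>

lemma holds_subst_fml:
  assumes "\<And>i. vars_trm (\<sigma> i) \<subseteq> {i}"
  shows "holds e (subst_fml \<sigma> A) \<longleftrightarrow> holds (\<lambda>i. val e (\<sigma> i)) A"
proof -
  have upd: "(\<lambda>i. val (e(x := n)) ((\<sigma>(x := Var x)) i)) = (\<lambda>i. val e (\<sigma> i))(x := n)"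
    if "\<And>i. vars_trm (\<sigma> i) \<subseteq> {i}" for e x n and \<sigma> :: "nat \<Rightarrow> trm"
    using that by (fastforce intro!: val_cong simp: fun_eq_iff)
  show ?thesis
    using assms
  proof (induction A arbitrary: e \<sigma>)
    case (All x A)
    then have "\<And>i. vars_trm ((\<sigma>(x := Var x)) i) \<subseteq> {i}" by simp
    from All.IH[OF this] show ?case by (simp only: subst_fml.simps holds.simps upd[OF All.prems])
  next
    case (Ex x A)
    then have "\<And>i. vars_trm ((\<sigma>(x := Var x)) i) \<subseteq> {i}" by simp
    from Ex.IH[OF this] show ?case by (simp only: subst_fml.simps holds.simps upd[OF Ex.prems])
  qed (simp_all add: val_subst_trm)
qed

lemma N_models_subst_num: "N_models (subst_fml (\<lambda>_. num a) A) \<longleftrightarrow> holds (\<lambda>_. a) A"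
proof -
  have "vars_trm (num a) = {}" "val e (num a) = a" for e
    by (induction a) auto
  then show ?thesis by (simp add: N_models_def holds_subst_fml)
qed

text \<open>\<open>K\<close>-tuples of numbers below \<open>D\<close> are represented by the numbers below
  \<open>D ^ K\<close>; as assignments they are \<open>0\<close> outside of \<open>{..<K}\<close>.\<close>

lemma digit_less: "0 < b \<Longrightarrow> digit b m i < b"
  by (simp add: digit_def)

lemma digit_eq_0: "m < b ^ K \<Longrightarrow> K \<le> i \<Longrightarrow> 0 < b \<Longrightarrow> digit b m i = 0"
  using power_increasing[of K i b] by (simp add: digit_def)

lemma ex_digits:
  assumes "\<And>i. f i < D" "\<And>i. K \<le> i \<Longrightarrow> f i = 0"
  obtains \<epsilon> where "\<epsilon> < D ^ K" "digit D \<epsilon> = f"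
proof
  let ?\<epsilon> = "\<Sum>k<K. f k * D ^ k"
  show "?\<epsilon> < D ^ K" using assms by (intro sum_digits_less)
  have "0 < D" using assms(1)[of 0] by simp
  then have "digit D ?\<epsilon> i = f i" for i
    using digit_sum[of K f D i] digit_eq_0[OF \<open>?\<epsilon> < D ^ K\<close>] assms by (cases "i < K") auto
  then show "digit D ?\<epsilon> = f" by blast
qed

text \<open>Only the digits below \<open>K\<close> are compared, which makes this a bounded
  quantifier; for codes below \<open>D ^ K\<close> the other digits are 0 anyway.\<close>

definition variant :: "nat \<Rightarrow> nat \<Rightarrow> nat \<Rightarrow> nat \<Rightarrow> nat \<Rightarrow> bool" where
  "variant D K j \<epsilon> \<epsilon>' \<longleftrightarrow> (\<forall>i<K. i = j \<or> digit D \<epsilon> i = digit D \<epsilon>' i)"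

lemma variant_iff:
  assumes "\<epsilon> < D ^ K" "\<epsilon>' < D ^ K" "j < K" "0 < D"
  shows "variant D K j \<epsilon> \<epsilon>' \<longleftrightarrow> digit D \<epsilon>' = (digit D \<epsilon>)(j := digit D \<epsilon>' j)"
proof -
  have "digit D \<epsilon>' i = digit D \<epsilon> i" if "K \<le> i" for i
    using that assms by (simp add: digit_eq_0)
  then show ?thesis
    using assms by (auto simp: variant_def fun_eq_iff) (metis not_le)
qed

text \<open>This turns a bounded quantifier over numbers into a search through assignment codes.
  Since \<open>m < D\<close>, each new value \<open>n\<close> is a legal digit and the updated
  assignment has a code.\<close>

lemma ex_variant_iff:
  assumes "\<epsilon> < D ^ K" "j < K" "m < D"
  shows "(\<exists>\<epsilon>'<D ^ K. variant D K j \<epsilon> \<epsilon>' \<and> digit D \<epsilon>' j \<le> m \<and> P (digit D \<epsilon>')) \<longleftrightarrow>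
    (\<exists>n\<le>m. P ((digit D \<epsilon>)(j := n)))" (is "?L \<longleftrightarrow> ?R")
proof
  assume ?L
  then obtain \<epsilon>' where \<epsilon>': "\<epsilon>' < D ^ K" "variant D K j \<epsilon> \<epsilon>'" "digit D \<epsilon>' j \<le> m" "P (digit D \<epsilon>')"
    by blast
  then have "digit D \<epsilon>' = (digit D \<epsilon>)(j := digit D \<epsilon>' j)" using assms variant_iff by simp
  then show ?R using \<epsilon>' by metis
next
  assume ?R
  then obtain n where n: "n \<le> m" "P ((digit D \<epsilon>)(j := n))" by blast
  have "((digit D \<epsilon>)(j := n)) i < D" for i using n assms by (simp add: digit_less)
  moreover have "((digit D \<epsilon>)(j := n)) i = 0" if "K \<le> i" for i
    using that assms by (simp add: digit_eq_0)
  ultimately obtain \<epsilon>' where \<epsilon>': "\<epsilon>' < D ^ K" "digit D \<epsilon>' = (digit D \<epsilon>)(j := n)"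
    by (rule ex_digits)
  then have "variant D K j \<epsilon> \<epsilon>'" using assms variant_iff by simp
  then show ?L using n \<epsilon>' by (intro exI[of _ \<epsilon>']) simp
qed

lemma pr_variant [pr_intros]:
  assumes "primitive_recursive n D" "primitive_recursive n K" "primitive_recursive n j"
    "primitive_recursive n f" "primitive_recursive n g"
  shows "primitive_recursive_pred n (\<lambda>xs. variant (D xs) (K xs) (j xs) (f xs) (g xs))"
  unfolding variant_def by (intro pr_intros pr_tl assms)

subsection \<open>Evaluation of bounded formulas\<close>

text \<open>The coding functions, whose existence alone is assumed in \<open>goedel_coding\<close>,
  become named curried parameters here, so that definitions can refer to them.\<close>

locale primitive_recursive_coding =
  fixes code_trm :: "trm \<Rightarrow> nat" and code_fml :: "fml \<Rightarrow> nat"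
    and is_var :: "nat \<Rightarrow> bool" and index :: "nat \<Rightarrow> nat"
    and add mul eq le conj disj imp :: "nat \<Rightarrow> nat \<Rightarrow> nat" and neg :: "nat \<Rightarrow> nat"
    and ball bex :: "nat \<Rightarrow> nat \<Rightarrow> nat \<Rightarrow> nat"
  assumes inj_codes: "inj (case_sum code_trm code_fml)"
    and is_var_iff: "is_var y \<longleftrightarrow> (\<exists>i. y = code_trm (Var i))"
    and index_code: "index (code_trm (Var i)) = i"
    and code_Add: "code_trm (Add t s) = add (code_trm t) (code_trm s)"
    and code_Mul: "code_trm (Mul t s) = mul (code_trm t) (code_trm s)"
    and code_Eq: "code_fml (Eq t s) = eq (code_trm t) (code_trm s)"
    and code_Le: "code_fml (Le t s) = le (code_trm t) (code_trm s)"
    and code_Neg: "code_fml (Neg A) = neg (code_fml A)"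
    and code_And: "code_fml (And A B) = conj (code_fml A) (code_fml B)"
    and code_Or: "code_fml (Or A B) = disj (code_fml A) (code_fml B)"
    and code_Imp: "code_fml (Imp A B) = imp (code_fml A) (code_fml B)"
    and code_BAll: "x \<notin> vars_trm t \<Longrightarrow>
      code_fml (BAll x t A) = ball (code_trm (Var x)) (code_trm t) (code_fml A)"
    and code_BEx: "x \<notin> vars_trm t \<Longrightarrow>
      code_fml (BEx x t A) = bex (code_trm (Var x)) (code_trm t) (code_fml A)"
    and less_trm: "code_trm t < code_trm (Add t s)" "code_trm s < code_trm (Add t s)"
      "code_trm t < code_trm (Mul t s)" "code_trm s < code_trm (Mul t s)"
    and less_fml: "code_trm t < code_fml (Eq t s)" "code_trm s < code_fml (Eq t s)"
      "code_trm t < code_fml (Le t s)" "code_trm s < code_fml (Le t s)"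
      "code_fml A < code_fml (Neg A)"
      "code_fml A < code_fml (And A B)" "code_fml B < code_fml (And A B)"
      "code_fml A < code_fml (Or A B)" "code_fml B < code_fml (Or A B)"
      "code_fml A < code_fml (Imp A B)" "code_fml B < code_fml (Imp A B)"
      "x \<notin> vars_trm t \<Longrightarrow> code_trm (Var x) < code_fml (BAll x t A)"
      "x \<notin> vars_trm t \<Longrightarrow> code_trm t < code_fml (BAll x t A)"
      "x \<notin> vars_trm t \<Longrightarrow> code_fml A < code_fml (BAll x t A)"
      "x \<notin> vars_trm t \<Longrightarrow> code_trm (Var x) < code_fml (BEx x t A)"
      "x \<notin> vars_trm t \<Longrightarrow> code_trm t < code_fml (BEx x t A)"
      "x \<notin> vars_trm t \<Longrightarrow> code_fml A < code_fml (BEx x t A)"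
    and pr_is_var: "primitive_recursive_pred 1 (\<lambda>xs. is_var (xs ! 0))"
    and pr_index: "primitive_recursive 1 (\<lambda>xs. index (xs ! 0))"
    and pr_neg: "primitive_recursive 1 (\<lambda>xs. neg (xs ! 0))"
    and pr_binary: "primitive_recursive 2 (\<lambda>xs. add (xs ! 0) (xs ! 1))"
      "primitive_recursive 2 (\<lambda>xs. mul (xs ! 0) (xs ! 1))"
      "primitive_recursive 2 (\<lambda>xs. eq (xs ! 0) (xs ! 1))"
      "primitive_recursive 2 (\<lambda>xs. le (xs ! 0) (xs ! 1))"
      "primitive_recursive 2 (\<lambda>xs. conj (xs ! 0) (xs ! 1))"
      "primitive_recursive 2 (\<lambda>xs. disj (xs ! 0) (xs ! 1))"
      "primitive_recursive 2 (\<lambda>xs. imp (xs ! 0) (xs ! 1))"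
    and pr_ternary: "primitive_recursive 3 (\<lambda>xs. ball (xs ! 0) (xs ! 1) (xs ! 2))"
      "primitive_recursive 3 (\<lambda>xs. bex (xs ! 0) (xs ! 1) (xs ! 2))"
begin

lemmas pr_code_intros = pr_intros
  pr_comp1[OF pr_is_var] pr_comp1[OF pr_index] pr_comp1[OF pr_neg]
  pr_binary[THEN pr_comp2] pr_ternary[THEN pr_comp3]

section \<open>Recognising codes of terms and bounded formulas\<close>

lemma code_inject [simp]:
  "code_trm t = code_trm s \<longleftrightarrow> t = s" "code_fml A = code_fml B \<longleftrightarrow> A = B"
  "code_trm t \<noteq> code_fml A" "code_fml A \<noteq> code_trm t"
  using injD[OF inj_codes, of "Inl t" "Inl s"] injD[OF inj_codes, of "Inr A" "Inr B"]
    injD[OF inj_codes, of "Inl t" "Inr A"] by auto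

declare index_code [simp] less_trm [simp] less_fml [simp]

text \<open>Codes of terms in which \<open>v\<^sub>k\<^sub>-\<^sub>1\<close> does not occur; for \<open>k = 0\<close> there is no
  restriction.\<close>

definition avoids :: "nat \<Rightarrow> nat \<Rightarrow> bool" where
  "avoids k y \<longleftrightarrow> (\<exists>t. y = code_trm t \<and> (\<forall>i \<in> vars_trm t. Suc i \<noteq> k))"

lemma avoids_0_code [simp]: "avoids 0 (code_trm t)"
  and avoids_Suc_code [simp]: "avoids (Suc i) (code_trm t) \<longleftrightarrow> i \<notin> vars_trm t"
  and avoids_0_code_fml [simp]: "\<not> avoids 0 (code_fml A)"
  by (auto simp: avoids_def)

text \<open>Constituents have smaller codes, so parsing is a bounded search. The parameter
  \<open>k\<close> stays fixed, so one recursion serves both for recognising terms and for testing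
  occurrence of a variable.\<close>

lemma avoids_rec:
  "avoids k y \<longleftrightarrow> is_var y \<and> Suc (index y) \<noteq> k \<or> y = code_trm Zero \<or> y = code_trm One \<or>
    (\<exists>t<y. \<exists>s<y. avoids k t \<and> avoids k s \<and> (add t s = y \<or> mul t s = y))" (is "?L \<longleftrightarrow> ?R")
proof
  assume ?L
  then obtain t where t: "y = code_trm t" "\<forall>i \<in> vars_trm t. Suc i \<noteq> k" by (auto simp: avoids_def)
  show ?R
  proof (cases t)
    case (Add u v)
    have "avoids k (code_trm u)" "avoids k (code_trm v)" using t Add by (auto simp: avoids_def)
    moreover have "code_trm u < y" "code_trm v < y"
      using t Add by simp_all
    moreover have "add (code_trm u) (code_trm v) = y"
      using t Add by (simp add: code_Add)
    ultimately show ?thesis by blast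
  next
    case (Mul u v)
    have "avoids k (code_trm u)" "avoids k (code_trm v)" using t Mul by (auto simp: avoids_def)
    moreover have "code_trm u < y" "code_trm v < y"
      using t Mul by simp_all
    moreover have "mul (code_trm u) (code_trm v) = y"
      using t Mul by (simp add: code_Mul)
    ultimately show ?thesis by blast
  qed (use t in \<open>auto simp: is_var_iff\<close>)
next
  assume ?R
  then consider i where "y = code_trm (Var i)" "Suc i \<noteq> k" | "y = code_trm Zero" | "y = code_trm One"
    | t s where "avoids k t" "avoids k s" "add t s = y \<or> mul t s = y"
    by (auto simp: is_var_iff)
  then show ?L
  proof cases
    case (4 t s)
    then obtain u v where "t = code_trm u" "s = code_trm v"
      "\<forall>i \<in> vars_trm u \<union> vars_trm v. Suc i \<noteq> k"
      by (auto simp: avoids_def)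
    then have "y = code_trm (Add u v) \<or> y = code_trm (Mul u v)"
      "\<forall>i \<in> vars_trm (Add u v) \<union> vars_trm (Mul u v). Suc i \<noteq> k"
      using 4 by (auto simp: code_Add code_Mul)
    then show ?thesis by (auto simp: avoids_def)
  qed (force simp: avoids_def)+
qed

lemma pr_avoids: "primitive_recursive_pred 2 (\<lambda>xs. avoids (xs ! 0) (xs ! 1))"
proof -
  \<comment> \<open>The argument list is \<open>y\<close>, the history, \<open>k\<close>; the status
    of smaller codes is read off the history.\<close>
  have "primitive_recursive_pred (1 + 2) (\<lambda>xs. is_var (xs ! 0) \<and> \<not> Suc (index (xs ! 0)) = xs ! 2 \<or>
    xs ! 0 = code_trm Zero \<or> xs ! 0 = code_trm One \<or>
    (\<exists>t<xs ! 0. \<exists>s<xs ! 0. digit 2 (xs ! 1) t \<noteq> 0 \<and> digit 2 (xs ! 1) s \<noteq> 0 \<and>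
      (add t s = xs ! 0 \<or> mul t s = xs ! 0)))"
    (is "primitive_recursive_pred _ ?P")
    by (intro pr_code_intros) simp_all
  then have "primitive_recursive_pred (1 + 1) (\<lambda>xs. avoids (tl xs ! 0) (hd xs))"
  proof (rule course_of_values_pred)
    fix y H :: nat and xs :: "nat list"
    assume "\<And>z. z < y \<Longrightarrow> digit 2 H z = of_bool (avoids (xs ! 0) z)"
    then have "digit 2 H z = 0 \<longleftrightarrow> \<not> avoids (xs ! 0) z" if "z < y" for z
      using that by simp
    then show "?P (y # H # xs) = avoids (xs ! 0) y"
      unfolding avoids_rec[of "xs ! 0" y] by (simp cong: conj_cong)
  qed
  then have "primitive_recursive_pred 2 (\<lambda>xs. avoids (xs ! 1) (xs ! 0))"
    unfolding one_add_one by (rule pr_cong) (auto simp: length_Suc_conv numeral_2_eq_2)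
  from pr_comp2[of "\<lambda>y k. of_bool (avoids k y)", OF this, of 2 "\<lambda>xs. xs ! 1" "\<lambda>xs. xs ! 0"]
  show ?thesis by (simp add: pr_intros)
qed

definition is_Delta0 :: "nat \<Rightarrow> bool" where
  "is_Delta0 y \<longleftrightarrow> (\<exists>A. y = code_fml A \<and> Delta0 A)"

lemma is_Delta0_code [simp]: "is_Delta0 (code_fml A) \<longleftrightarrow> Delta0 A"
  by (auto simp: is_Delta0_def)

text \<open>This lemma and the next three replace searches through codes by searches through syntax,
  where injectivity of the coding can be used for rewriting.\<close>

lemma ex_trm_code: "(\<exists>t<y. avoids 0 t \<and> P t) \<longleftrightarrow> (\<exists>t. code_trm t < y \<and> P (code_trm t))"
  by (auto simp: avoids_def)

lemma ex_avoiding_code: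
  "(\<exists>t<y. avoids (Suc i) t \<and> P t) \<longleftrightarrow> (\<exists>t. code_trm t < y \<and> i \<notin> vars_trm t \<and> P (code_trm t))"
  by (auto simp: avoids_def)

lemma ex_Delta0_code:
  "(\<exists>A<y. is_Delta0 A \<and> P A) \<longleftrightarrow> (\<exists>A. code_fml A < y \<and> Delta0 A \<and> P (code_fml A))"
  by (auto simp: is_Delta0_def)

lemma ex_var_code: "(\<exists>v<y. is_var v \<and> P v) \<longleftrightarrow> (\<exists>i. code_trm (Var i) < y \<and> P (code_trm (Var i)))"
  by (auto simp: is_var_iff)

lemmas ex_codes = ex_trm_code ex_avoiding_code ex_Delta0_code ex_var_code

lemmas code_fml_folds = code_Eq[symmetric] code_Le[symmetric] code_Neg[symmetric]
  code_And[symmetric] code_Or[symmetric] code_Imp[symmetric] code_BAll[symmetric] code_BEx[symmetric]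

text \<open>The guards stand before the equations because the coding functions are known only at
  codes of constituents, and \<open>ball\<close> and \<open>bex\<close> only if the variable does
  not occur in the bound.\<close>

lemma is_Delta0_rec:
  "is_Delta0 y \<longleftrightarrow>
    (\<exists>t<y. avoids 0 t \<and> (\<exists>s<y. avoids 0 s \<and> (eq t s = y \<or> le t s = y))) \<or>
    (\<exists>A<y. is_Delta0 A \<and> neg A = y) \<or>
    (\<exists>A<y. is_Delta0 A \<and>
      (\<exists>B<y. is_Delta0 B \<and> (conj A B = y \<or> disj A B = y \<or> imp A B = y))) \<or>
    (\<exists>v<y. is_var v \<and> (\<exists>t<y. avoids (Suc (index v)) t \<and>
      (\<exists>A<y. is_Delta0 A \<and> (ball v t A = y \<or> bex v t A = y))))" (is "?L \<longleftrightarrow> ?R")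
proof
  assume ?L
  then obtain A where "y = code_fml A" "Delta0 A" by (auto simp: is_Delta0_def)
  from this(2) show ?R
    unfolding \<open>y = code_fml A\<close> ex_codes
    by (cases rule: Delta0.cases) (simp_all add: code_fml_folds cong: conj_cong)
next
  assume ?R
  then show ?L
    unfolding ex_codes by (auto simp: code_fml_folds intro: Delta0.intros cong: conj_cong)
qed

lemmas pr_avoids_intro = pr_comp2[of "\<lambda>k y. of_bool (avoids k y)", OF pr_avoids]

lemma pr_is_Delta0: "primitive_recursive_pred 1 (\<lambda>xs. is_Delta0 (xs ! 0))"
proof -
  have "primitive_recursive_pred (0 + 2) (\<lambda>xs.
    (\<exists>t<xs ! 0. avoids 0 t \<and> (\<exists>s<xs ! 0. avoids 0 s \<and> (eq t s = xs ! 0 \<or> le t s = xs ! 0))) \<or>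
    (\<exists>A<xs ! 0. digit 2 (xs ! 1) A \<noteq> 0 \<and> neg A = xs ! 0) \<or>
    (\<exists>A<xs ! 0. digit 2 (xs ! 1) A \<noteq> 0 \<and> (\<exists>B<xs ! 0. digit 2 (xs ! 1) B \<noteq> 0 \<and>
      (conj A B = xs ! 0 \<or> disj A B = xs ! 0 \<or> imp A B = xs ! 0))) \<or>
    (\<exists>v<xs ! 0. is_var v \<and> (\<exists>t<xs ! 0. avoids (Suc (index v)) t \<and>
      (\<exists>A<xs ! 0. digit 2 (xs ! 1) A \<noteq> 0 \<and> (ball v t A = xs ! 0 \<or> bex v t A = xs ! 0)))))"
    (is "primitive_recursive_pred _ ?P")
    by (intro pr_code_intros pr_avoids_intro) simp_all
  then have "primitive_recursive_pred (0 + 1) (\<lambda>xs. is_Delta0 (hd xs))"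
  proof (rule course_of_values_pred)
    fix y H :: nat and xs :: "nat list"
    assume "\<And>z. z < y \<Longrightarrow> digit 2 H z = of_bool (is_Delta0 z)"
    then have "digit 2 H z = 0 \<longleftrightarrow> \<not> is_Delta0 z" if "z < y" for z
      using that by simp
    then show "?P (y # H # xs) = is_Delta0 y"
      unfolding is_Delta0_rec[of y] by (simp cong: conj_cong)
  qed
  then show ?thesis
    unfolding add_0 by (rule pr_cong) (auto simp: length_Suc_conv)
qed

section \<open>The evaluation step and its course-of-values recursion\<close>

text \<open>One step of the evaluation of the term or \<open>\<Delta>\<^sub>0\<close>-formula with code \<open>y\<close> under the
  assignment with code \<open>\<epsilon>\<close>, where \<open>L\<close> holds the values of the constituents.\<close>

definition trm_step :: "nat \<Rightarrow> (nat \<Rightarrow> nat \<Rightarrow> nat) \<Rightarrow> nat \<Rightarrow> nat \<Rightarrow> nat" where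
  "trm_step D L y \<epsilon> =
    (if is_var y then digit D \<epsilon> (index y) else if y = code_trm One then 1
     else \<Sum>t<y. \<Sum>s<y. of_bool (avoids 0 t \<and> avoids 0 s) *
       (of_bool (add t s = y) * (L t \<epsilon> + L s \<epsilon>) + of_bool (mul t s = y) * (L t \<epsilon> * L s \<epsilon>)))"

text \<open>Universal quantification is a negated search for a counterexample, so that one fact
  about searches through variants later covers both quantifiers.\<close>

definition fml_step :: "nat \<Rightarrow> nat \<Rightarrow> (nat \<Rightarrow> nat \<Rightarrow> nat) \<Rightarrow> nat \<Rightarrow> nat \<Rightarrow> bool" where
  "fml_step D K L y \<epsilon> \<longleftrightarrow>
    (\<exists>t<y. avoids 0 t \<and> (\<exists>s<y. avoids 0 s \<and>
      (eq t s = y \<and> L t \<epsilon> = L s \<epsilon> \<or> le t s = y \<and> L t \<epsilon> \<le> L s \<epsilon>))) \<or>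
    (\<exists>A<y. is_Delta0 A \<and> neg A = y \<and> \<not> L A \<epsilon> = 1) \<or>
    (\<exists>A<y. is_Delta0 A \<and> (\<exists>B<y. is_Delta0 B \<and>
      (conj A B = y \<and> L A \<epsilon> = 1 \<and> L B \<epsilon> = 1 \<or> disj A B = y \<and> (L A \<epsilon> = 1 \<or> L B \<epsilon> = 1) \<or>
       imp A B = y \<and> (L A \<epsilon> = 1 \<longrightarrow> L B \<epsilon> = 1)))) \<or>
    (\<exists>v<y. is_var v \<and> (\<exists>t<y. avoids (Suc (index v)) t \<and> (\<exists>A<y. is_Delta0 A \<and>
      (ball v t A = y \<and> \<not> (\<exists>\<epsilon>'<D ^ K.
          variant D K (index v) \<epsilon> \<epsilon>' \<and> digit D \<epsilon>' (index v) \<le> L t \<epsilon> \<and> \<not> L A \<epsilon>' = 1) \<or>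
       bex v t A = y \<and> (\<exists>\<epsilon>'<D ^ K.
          variant D K (index v) \<epsilon> \<epsilon>' \<and> digit D \<epsilon>' (index v) \<le> L t \<epsilon> \<and> L A \<epsilon>' = 1)))))"

definition step :: "nat \<Rightarrow> nat \<Rightarrow> (nat \<Rightarrow> nat \<Rightarrow> nat) \<Rightarrow> nat \<Rightarrow> nat \<Rightarrow> nat" where
  "step D K L y \<epsilon> =
    (if avoids 0 y then trm_step D L y \<epsilon> else of_bool (fml_step D K L y \<epsilon>))"

text \<open>The double sum in \<open>trm_step\<close> acts as a definite description: by unique
  readability only the actual pair of constituents can contribute.\<close>

lemma sum_sum_single:
  fixes f :: "nat \<Rightarrow> nat \<Rightarrow> nat"
  assumes "u < y" "v < y" "\<And>t s. t \<noteq> u \<or> s \<noteq> v \<Longrightarrow> f t s = 0"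
  shows "(\<Sum>t<y. \<Sum>s<y. f t s) = f u v"
proof -
  have "(\<Sum>s<y. f t s) = (if t = u then f u v else 0)" for t
  proof -
    have "(\<Sum>s<y. f t s) = (\<Sum>s<y. if s = v then (if t = u then f u v else 0) else 0)"
      using assms(3) by (intro sum.cong) auto
    then show ?thesis using assms(2) by simp
  qed
  then show ?thesis using assms(1) by simp
qed

lemma step_trm:
  "step D K L (code_trm (Var i)) \<epsilon> = digit D \<epsilon> i"
  "step D K L (code_trm Zero) \<epsilon> = 0"
  "step D K L (code_trm One) \<epsilon> = 1"
  "step D K L (code_trm (Add t s)) \<epsilon> = L (code_trm t) \<epsilon> + L (code_trm s) \<epsilon>"
  "step D K L (code_trm (Mul t s)) \<epsilon> = L (code_trm t) \<epsilon> * L (code_trm s) \<epsilon>"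
proof -
  show "step D K L (code_trm (Var i)) \<epsilon> = digit D \<epsilon> i" "step D K L (code_trm One) \<epsilon> = 1"
    by (auto simp: step_def trm_step_def is_var_iff)
  \<comment> \<open>\<open>Zero\<close> has no clause of its own: no sum or product has its code, so
    the double sum vanishes.\<close>
  show "step D K L (code_trm Zero) \<epsilon> = 0"
    by (auto simp: step_def trm_step_def is_var_iff avoids_def simp flip: code_Add code_Mul)
  show "step D K L (code_trm (Add t s)) \<epsilon> = L (code_trm t) \<epsilon> + L (code_trm s) \<epsilon>"
    unfolding step_def trm_step_def
    by (subst sum_sum_single[of "code_trm t" _ "code_trm s"])
      (auto simp: is_var_iff avoids_def simp flip: code_Add code_Mul)
  show "step D K L (code_trm (Mul t s)) \<epsilon> = L (code_trm t) \<epsilon> * L (code_trm s) \<epsilon>"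
    unfolding step_def trm_step_def
    by (subst sum_sum_single[of "code_trm t" _ "code_trm s"])
      (auto simp: is_var_iff avoids_def simp flip: code_Add code_Mul)
qed

text \<open>Unique readability: the code determines the outermost symbol and the constituents, so
  the disjunction in \<open>fml_step\<close> collapses to the matching clause.\<close>

lemma step_fml:
  "step D K L (code_fml (Eq t s)) \<epsilon> = of_bool (L (code_trm t) \<epsilon> = L (code_trm s) \<epsilon>)"
  "step D K L (code_fml (Le t s)) \<epsilon> = of_bool (L (code_trm t) \<epsilon> \<le> L (code_trm s) \<epsilon>)"
  "Delta0 A \<Longrightarrow> step D K L (code_fml (Neg A)) \<epsilon> = of_bool (L (code_fml A) \<epsilon> \<noteq> 1)"
  "Delta0 A \<Longrightarrow> Delta0 B \<Longrightarrow> step D K L (code_fml (And A B)) \<epsilon> =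
    of_bool (L (code_fml A) \<epsilon> = 1 \<and> L (code_fml B) \<epsilon> = 1)"
  "Delta0 A \<Longrightarrow> Delta0 B \<Longrightarrow> step D K L (code_fml (Or A B)) \<epsilon> =
    of_bool (L (code_fml A) \<epsilon> = 1 \<or> L (code_fml B) \<epsilon> = 1)"
  "Delta0 A \<Longrightarrow> Delta0 B \<Longrightarrow> step D K L (code_fml (Imp A B)) \<epsilon> =
    of_bool (L (code_fml A) \<epsilon> = 1 \<longrightarrow> L (code_fml B) \<epsilon> = 1)"
  "x \<notin> vars_trm t \<Longrightarrow> Delta0 A \<Longrightarrow> step D K L (code_fml (BAll x t A)) \<epsilon> =
    of_bool (\<not> (\<exists>\<epsilon>'<D ^ K. variant D K x \<epsilon> \<epsilon>' \<and>
      digit D \<epsilon>' x \<le> L (code_trm t) \<epsilon> \<and> L (code_fml A) \<epsilon>' \<noteq> 1))"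
  "x \<notin> vars_trm t \<Longrightarrow> Delta0 A \<Longrightarrow> step D K L (code_fml (BEx x t A)) \<epsilon> =
    of_bool (\<exists>\<epsilon>'<D ^ K. variant D K x \<epsilon> \<epsilon>' \<and>
      digit D \<epsilon>' x \<le> L (code_trm t) \<epsilon> \<and> L (code_fml A) \<epsilon>' = 1)"
  unfolding step_def fml_step_def ex_codes
  by (simp_all add: code_fml_folds cong: conj_cong)

text \<open>A step consults \<open>L\<close> only at smaller codes and at assignments below
  \<open>D ^ K\<close>; these are exactly the entries that a history is sure to contain.\<close>

lemma step_cong:
  assumes "\<And>z \<epsilon>'. z < y \<Longrightarrow> \<epsilon>' < D ^ K \<Longrightarrow> L z \<epsilon>' = L' z \<epsilon>'" "\<epsilon> < D ^ K"
  shows "step D K L y \<epsilon> = step D K L' y \<epsilon>"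
proof -
  have "trm_step D L y \<epsilon> = trm_step D L' y \<epsilon>"
    unfolding trm_step_def using assms by (auto intro!: sum.cong)
  moreover have "fml_step D K L y \<epsilon> = fml_step D K L' y \<epsilon>"
    unfolding fml_step_def using assms by (simp cong: conj_cong)
  ultimately show ?thesis by (simp add: step_def)
qed

text \<open>Values are obtained modulo \<open>D\<close> because they must be digits of the history;
  \<open>evaluation\<close> removes the remainder by a size bound.\<close>

lemma evaluator:
  obtains W where
    "primitive_recursive 4 (\<lambda>xs. W (xs ! 0) (xs ! 1) (xs ! 2) (xs ! 3))"
    "\<And>D K y \<epsilon>. \<epsilon> < D ^ K \<Longrightarrow> 0 < D \<Longrightarrow> W D K y \<epsilon> = step D K (W D K) y \<epsilon> mod D"
proof -
  \<comment> \<open>The arguments are the position, the history, \<open>D\<close> and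
    \<open>K\<close>. Quotient and remainder by \<open>D ^ K\<close> split the position into code
    and assignment; \<open>D\<close> is also the base of the history.\<close>
  have "primitive_recursive (2 + 2) (\<lambda>xs. step (xs ! 2) (xs ! 3)
    (\<lambda>z \<epsilon>'. digit (xs ! 2) (xs ! 1) (z * xs ! 2 ^ xs ! 3 + \<epsilon>'))
    (xs ! 0 div xs ! 2 ^ xs ! 3) (xs ! 0 mod xs ! 2 ^ xs ! 3))"
    unfolding step_def trm_step_def fml_step_def
    by (intro pr_code_intros pr_avoids_intro pr_comp1[OF pr_is_Delta0]) simp_all
  moreover have "primitive_recursive 2 (\<lambda>xs. xs ! 0)" by (simp add: pr_intros)
  ultimately obtain F where F: "primitive_recursive (2 + 1) (\<lambda>xs. F (hd xs) (tl xs))"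
    and F_rec: "\<And>p xs. \<lbrakk>length xs = 2; 0 < xs ! 0\<rbrakk> \<Longrightarrow> \<exists>H. F p xs =
      step (xs ! 0) (xs ! 1) (\<lambda>z \<epsilon>'. digit (xs ! 0) H (z * xs ! 0 ^ xs ! 1 + \<epsilon>'))
      (p div xs ! 0 ^ xs ! 1) (p mod xs ! 0 ^ xs ! 1) mod xs ! 0 \<and>
      (\<forall>q<p. digit (xs ! 0) H q = F q xs)"
    by (rule course_of_values) (simp add: numeral_3_eq_3 numeral_2_eq_2)
  define W where "W D K y \<epsilon> = F (y * D ^ K + \<epsilon>) [D, K]" for D K y \<epsilon>
  let ?gs = "[\<lambda>xs. xs ! 2 * xs ! 0 ^ xs ! 1 + xs ! 3, \<lambda>xs. xs ! 0, \<lambda>xs. xs ! 1]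
    :: (nat list \<Rightarrow> nat) list"
  have "\<forall>g \<in> set ?gs. primitive_recursive 4 g"
    by (simp add: pr_intros)
  moreover have "primitive_recursive (length ?gs) (\<lambda>xs. F (hd xs) (tl xs))"
    using F by (simp add: numeral_3_eq_3)
  ultimately have "primitive_recursive 4 (\<lambda>xs. W (xs ! 0) (xs ! 1) (xs ! 2) (xs ! 3))"
    using primitive_recursive.comp[of ?gs "\<lambda>xs. F (hd xs) (tl xs)" 4] by (simp add: W_def)
  moreover have "W D K y \<epsilon> = step D K (W D K) y \<epsilon> mod D"
    if \<epsilon>: "\<epsilon> < D ^ K" "0 < D" for D K y \<epsilon>
  proof -
    obtain H where H: "F (y * D ^ K + \<epsilon>) [D, K] =
        step D K (\<lambda>z \<epsilon>'. digit D H (z * D ^ K + \<epsilon>')) y \<epsilon> mod D"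
      "\<forall>q < y * D ^ K + \<epsilon>. digit D H q = F q [D, K]"
      using F_rec[of "[D, K]" "y * D ^ K + \<epsilon>"] \<epsilon> by auto
    have "z * D ^ K + \<epsilon>' < y * D ^ K + \<epsilon>" if "z < y" "\<epsilon>' < D ^ K" for z \<epsilon>'
    proof -
      have "Suc z * D ^ K \<le> y * D ^ K" using that by (intro mult_right_mono) auto
      then show ?thesis using that by simp
    qed
    then have "step D K (\<lambda>z \<epsilon>'. digit D H (z * D ^ K + \<epsilon>')) y \<epsilon> = step D K (W D K) y \<epsilon>"
      using H(2) \<epsilon>(1) by (intro step_cong) (simp_all add: W_def)
    then show ?thesis using H(1) by (simp add: W_def)
  qed
  ultimately show ?thesis using that by blast
qed

section \<open>Size bounds and correctness of the evaluator\<close>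

text \<open>The offset 2 lets one product dominate both operations: \<open>(u + 2) * (v + 2)\<close>
  is at least \<open>u + v + 2\<close> and \<open>u * v + 2\<close>. So each operation at most
  squares the bound, while the code grows by at least 1.\<close>

lemma val_bound:
  assumes "\<And>i. e i + 2 \<le> M"
  shows "val e t + 2 \<le> M ^ 2 ^ Suc (code_trm t)"
proof -
  have M: "2 \<le> M" using assms[of 0] by simp
  have mono: "M ^ 2 ^ m \<le> M ^ 2 ^ n" if "m \<le> n" for m n
    using that M by (intro power_increasing) auto
  have square: "p * q \<le> M ^ 2 ^ Suc n"
    if "p \<le> M ^ 2 ^ n" "q \<le> M ^ 2 ^ n" for p q n
    using mult_mono[OF that] by (simp add: power_add[symmetric] mult_2)
  show ?thesis
  proof (induction t)
    case (Var i)
    then show ?case using assms[of i] mono[of 0 "Suc (code_trm (Var i))"] by simp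
  next
    case Zero
    then show ?case using M mono[of 0 "Suc (code_trm Zero)"] by simp
  next
    case One
    \<comment> \<open>Here 3 must be bounded although \<open>M\<close> may be 2 and the code 0; this
      is why the exponent has \<open>Suc\<close>.\<close>
    have "2 * 2 \<le> M ^ 2 ^ Suc 0" using M by (intro square) auto
    then show ?case using mono[of "Suc 0" "Suc (code_trm One)"] by simp
  next
    case (Add t s)
    have "val e t + 2 \<le> M ^ 2 ^ code_trm (Add t s)" "val e s + 2 \<le> M ^ 2 ^ code_trm (Add t s)"
      using Add mono[of "Suc (code_trm t)" "code_trm (Add t s)"]
        mono[of "Suc (code_trm s)" "code_trm (Add t s)"] by (simp_all add: Suc_le_eq)
    from square[OF this] show ?case by (simp add: algebra_simps)
  next
    case (Mul t s)
    have "val e t + 2 \<le> M ^ 2 ^ code_trm (Mul t s)" "val e s + 2 \<le> M ^ 2 ^ code_trm (Mul t s)"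
      using Mul mono[of "Suc (code_trm t)" "code_trm (Mul t s)"]
        mono[of "Suc (code_trm s)" "code_trm (Mul t s)"] by (simp_all add: Suc_le_eq)
    from square[OF this] show ?case by (simp add: algebra_simps)
  qed
qed

text \<open>Every variable occurring in a bounded formula has a smaller code than the formula.
  Stating agreement through codes matches the bound \<open>K\<close> on variable indices.\<close>

lemma holds_cong:
  assumes "Delta0 A" "\<And>i. code_trm (Var i) < code_fml A \<Longrightarrow> e i = e' i"
  shows "holds e A \<longleftrightarrow> holds e' A"
proof -
  have var_le: "code_trm (Var i) \<le> code_trm t" if "i \<in> vars_trm t" for i t
    using that by (induction t) (auto dest: less_imp_le intro: order.trans less_imp_le[OF less_trm(1)]
      less_imp_le[OF less_trm(2)] less_imp_le[OF less_trm(3)] less_imp_le[OF less_trm(4)])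
  have val: "val e t = val e' t"
    if "\<And>i. code_trm (Var i) < y \<Longrightarrow> e i = e' i" "code_trm t < y" for e e' t y
    using that var_le by (intro val_cong) (metis le_less_trans)
  have IH: "holds e A \<longleftrightarrow> holds e' A"
    if "\<And>e e'. (\<And>i. code_trm (Var i) < code_fml A \<Longrightarrow> e i = e' i) \<Longrightarrow> holds e A \<longleftrightarrow> holds e' A"
      "\<And>i. code_trm (Var i) < y \<Longrightarrow> e i = e' i" "code_fml A < y" for e e' A y
    using that by (meson less_trans)
  show ?thesis
    using assms
  proof (induction A arbitrary: e e')
    case (1 t s)
    then show ?case using val[OF 1] by simp
  next
    case (2 t s)
    then show ?case using val[OF 2] by simp
  next
    case (3 A)
    show ?case using IH[OF 3(2) 3(3)] by simp
  next
    case (4 A B)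
    show ?case using IH[OF 4(3) 4(5)] IH[OF 4(4) 4(5)] by simp
  next
    case (5 A B)
    show ?case using IH[OF 5(3) 5(5)] IH[OF 5(4) 5(5)] by simp
  next
    case (6 A B)
    show ?case using IH[OF 6(3) 6(5)] IH[OF 6(4) 6(5)] by simp
  next
    case (7 x t A)
    have "(e(x := n)) i = (e'(x := n)) i" if "code_trm (Var i) < code_fml (BAll x t A)" for n i
      using 7(4) that by simp
    note agree = this
    have "val (e(x := n)) t = val (e'(x := n)) t" for n
      by (rule val[OF agree less_fml(13)[OF 7(1)]])
    moreover have "holds (e(x := n)) A \<longleftrightarrow> holds (e'(x := n)) A" for n
      by (rule IH[OF 7(3) agree less_fml(14)[OF 7(1)]])
    ultimately show ?case by simp
  next
    case (8 x t A)
    have "(e(x := n)) i = (e'(x := n)) i" if "code_trm (Var i) < code_fml (BEx x t A)" for n i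
      using 8(4) that by simp
    note agree = this
    have "val (e(x := n)) t = val (e'(x := n)) t" for n
      by (rule val[OF agree less_fml(16)[OF 8(1)]])
    moreover have "holds (e(x := n)) A \<longleftrightarrow> holds (e'(x := n)) A" for n
      by (rule IH[OF 8(3) agree less_fml(17)[OF 8(1)]])
    ultimately show ?case by simp
  qed
qed

text \<open>Induction on the formula, with \<open>k\<close> counting the quantifiers entered.
  Entering one lets the new value reach that of the bounding term, so \<open>M k\<close> becomes
  \<open>M (Suc k)\<close>; meanwhile the code drops, so \<open>k + code_fml A\<close> stays at most
  \<open>x\<close> and all bounds stay at most \<open>D\<close>.\<close>

lemma evaluation:
  assumes W: "\<And>y \<epsilon>. \<epsilon> < D ^ K \<Longrightarrow> W y \<epsilon> = step D K W y \<epsilon> mod D"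
    and M: "\<And>k. M (Suc k) = M k ^ 2 ^ Suc x" "\<And>k. k \<le> Suc x \<Longrightarrow> M k \<le> D"
    and K: "\<And>i. code_trm (Var i) \<le> x \<Longrightarrow> i < K"
    and A: "Delta0 A" "k + code_fml A \<le> x" "\<epsilon> < D ^ K" "\<And>i. digit D \<epsilon> i + 2 \<le> M k"
  shows "W (code_fml A) \<epsilon> = of_bool (holds (digit D \<epsilon>) A)"
proof -
  have D: "2 \<le> D"
    using A(4)[of 0] M(2)[of k] A(2) by simp
  \<comment> \<open>Reduction modulo \<open>D\<close> commutes with sums and products, so sizes
    matter only once, for the whole term.\<close>
  have eval_mod: "W (code_trm t) \<epsilon> = val (digit D \<epsilon>) t mod D" if \<epsilon>: "\<epsilon> < D ^ K" for t \<epsilon>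
    by (induction t) (simp_all only: W[OF \<epsilon>] step_trm val.simps mod_add_eq mod_mult_eq)
  have val_le: "val (digit D \<epsilon>) t + 2 \<le> M (Suc k)"
    if "code_trm t \<le> x" "\<And>i. digit D \<epsilon> i + 2 \<le> M k" for t \<epsilon> k
  proof -
    have "val (digit D \<epsilon>) t + 2 \<le> M k ^ 2 ^ Suc (code_trm t)"
      by (rule val_bound) (rule that)
    also have "\<dots> \<le> M k ^ 2 ^ Suc x"
      using that(1) that(2)[of 0] by (intro power_increasing) auto
    finally show ?thesis by (simp add: M(1))
  qed
  have eval_trm: "W (code_trm t) \<epsilon> = val (digit D \<epsilon>) t"
    if "k + code_trm t \<le> x" "\<epsilon> < D ^ K" "\<And>i. digit D \<epsilon> i + 2 \<le> M k" for t \<epsilon> k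
    using eval_mod[OF that(2), of t] val_le[of t \<epsilon> k] M(2)[of "Suc k"] that by simp
  \<comment> \<open>Kept general in \<open>k\<close> and the assignment, since a quantifier calls it
    at \<open>Suc k\<close> and at variants.\<close>
  define correct where "correct A \<longleftrightarrow> (\<forall>k \<epsilon>. k + code_fml A \<le> x \<longrightarrow> \<epsilon> < D ^ K \<longrightarrow>
    (\<forall>i. digit D \<epsilon> i + 2 \<le> M k) \<longrightarrow> W (code_fml A) \<epsilon> = of_bool (holds (digit D \<epsilon>) A))" for A
  have quantifier: "(\<exists>\<epsilon>'<D ^ K. variant D K j \<epsilon> \<epsilon>' \<and> digit D \<epsilon>' j \<le> W (code_trm t) \<epsilon> \<and>
      P (W (code_fml A) \<epsilon>')) \<longleftrightarrow>
      (\<exists>n. n \<le> val ((digit D \<epsilon>)(j := n)) t \<and> P (of_bool (holds ((digit D \<epsilon>)(j := n)) A)))"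
    if "correct A"
      and j: "j \<notin> vars_trm t" "code_trm (Var j) < y"
      and less: "code_trm t < y" "code_fml A < y" "k + y \<le> x"
      and \<epsilon>: "\<epsilon> < D ^ K" "\<And>i. digit D \<epsilon> i + 2 \<le> M k"
    for j t A y k \<epsilon> and P :: "nat \<Rightarrow> bool"
  proof -
    let ?m = "val (digit D \<epsilon>) t"
    \<comment> \<open>\<open>holds\<close> evaluates the bounding term after the update, which does
      not affect it as \<open>j\<close> does not occur there.\<close>
    have val: "val ((digit D \<epsilon>)(j := n)) t = ?m" for n
      using j by (intro val_cong) auto
    have m: "?m + 2 \<le> M (Suc k)" using val_le[of t \<epsilon> k] less \<epsilon> by simp
    have "M k \<le> M k ^ 2 ^ Suc x" using \<epsilon>(2)[of 0] by (intro self_le_power) auto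
    then have mono: "M k \<le> M (Suc k)" by (simp add: M(1))
    have "W (code_fml A) \<epsilon>' = of_bool (holds (digit D \<epsilon>') A)"
      if \<epsilon>': "\<epsilon>' < D ^ K" "variant D K j \<epsilon> \<epsilon>'" "digit D \<epsilon>' j \<le> ?m" for \<epsilon>'
    proof (rule \<open>correct A\<close>[unfolded correct_def, rule_format, of "Suc k"])
      have "digit D \<epsilon>' = (digit D \<epsilon>)(j := digit D \<epsilon>' j)"
        by (rule variant_iff[THEN iffD1, OF \<epsilon>(1) \<epsilon>'(1) _ _ \<epsilon>'(2)]) (use D K j less in auto)
      then have "digit D \<epsilon>' i = digit D \<epsilon> i" if "i \<noteq> j" for i
        using that by (metis fun_upd_other)
      then show "digit D \<epsilon>' i + 2 \<le> M (Suc k)" for i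
        using \<epsilon>'(3) m \<epsilon>(2)[of i] mono by (cases "i = j") auto
    qed (use less \<epsilon>' in auto)
    then have "(\<exists>\<epsilon>'<D ^ K. variant D K j \<epsilon> \<epsilon>' \<and> digit D \<epsilon>' j \<le> W (code_trm t) \<epsilon> \<and>
      P (W (code_fml A) \<epsilon>')) \<longleftrightarrow> (\<exists>\<epsilon>'<D ^ K. variant D K j \<epsilon> \<epsilon>' \<and> digit D \<epsilon>' j \<le> ?m \<and>
      P (of_bool (holds (digit D \<epsilon>') A)))"
      using eval_trm[of k t \<epsilon>] less \<epsilon> by (simp cong: conj_cong)
    also have "\<dots> \<longleftrightarrow> (\<exists>n\<le>?m. P (of_bool (holds ((digit D \<epsilon>)(j := n)) A)))"
      using \<epsilon>(1) K[of j] j less m M(2)[of "Suc k"]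
      by (intro ex_variant_iff[where P = "\<lambda>e. P (of_bool (holds e A))"]) auto
    also have "(\<exists>n\<le>?m. P (of_bool (holds ((digit D \<epsilon>)(j := n)) A))) \<longleftrightarrow>
      (\<exists>n. n \<le> val ((digit D \<epsilon>)(j := n)) t \<and> P (of_bool (holds ((digit D \<epsilon>)(j := n)) A)))"
      by (simp add: val)
    finally show ?thesis .
  qed
  \<comment> \<open>Truth values are below \<open>D\<close>, as \<open>D\<close> is at least 2, so
    the remainder changes nothing.\<close>
  have eval: "W (code_fml A) \<epsilon> = step D K W (code_fml A) \<epsilon>" if "\<epsilon> < D ^ K" for A \<epsilon>
  proof -
    have "step D K W (code_fml A) \<epsilon> < D"
      using D by (simp add: step_def)
    then show ?thesis unfolding W[OF that, of "code_fml A"] by (rule mod_less)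
  qed
  have add_le: "k + z \<le> x" if "k + y \<le> x" "z < y" for k y z
    using that by simp
  show ?thesis
    using A
  proof (induction A arbitrary: k \<epsilon>)
    case (1 t s)
    have "W (code_trm t) \<epsilon> = val (digit D \<epsilon>) t" "W (code_trm s) \<epsilon> = val (digit D \<epsilon>) s"
      by (fact eval_trm[OF add_le[OF 1(1) less_fml(1)] 1(2,3)],
        fact eval_trm[OF add_le[OF 1(1) less_fml(2)] 1(2,3)])
    then show ?case
      unfolding eval[OF 1(2), of "Eq t s"] step_fml(1) by simp
  next
    case (2 t s)
    have "W (code_trm t) \<epsilon> = val (digit D \<epsilon>) t" "W (code_trm s) \<epsilon> = val (digit D \<epsilon>) s"
      by (fact eval_trm[OF add_le[OF 2(1) less_fml(3)] 2(2,3)],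
        fact eval_trm[OF add_le[OF 2(1) less_fml(4)] 2(2,3)])
    then show ?case
      unfolding eval[OF 2(2), of "Le t s"] step_fml(2) by simp
  next
    case (3 A)
    have "W (code_fml A) \<epsilon> = of_bool (holds (digit D \<epsilon>) A)"
      by (fact 3(2)[OF add_le[OF 3(3) less_fml(5)] 3(4,5)])
    then show ?case
      unfolding eval[OF 3(4), of "Neg A"] step_fml(3)[OF 3(1)] by simp
  next
    case (4 A B)
    have "W (code_fml A) \<epsilon> = of_bool (holds (digit D \<epsilon>) A)" "W (code_fml B) \<epsilon> = of_bool (holds (digit D \<epsilon>) B)"
      by (fact 4(3)[OF add_le[OF 4(5) less_fml(6)] 4(6,7)],
        fact 4(4)[OF add_le[OF 4(5) less_fml(7)] 4(6,7)])
    then show ?case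
      unfolding eval[OF 4(6), of "And A B"] step_fml(4)[OF 4(1,2)] by simp
  next
    case (5 A B)
    have "W (code_fml A) \<epsilon> = of_bool (holds (digit D \<epsilon>) A)" "W (code_fml B) \<epsilon> = of_bool (holds (digit D \<epsilon>) B)"
      by (fact 5(3)[OF add_le[OF 5(5) less_fml(8)] 5(6,7)],
        fact 5(4)[OF add_le[OF 5(5) less_fml(9)] 5(6,7)])
    then show ?case
      unfolding eval[OF 5(6), of "Or A B"] step_fml(5)[OF 5(1,2)] by simp
  next
    case (6 A B)
    have "W (code_fml A) \<epsilon> = of_bool (holds (digit D \<epsilon>) A)" "W (code_fml B) \<epsilon> = of_bool (holds (digit D \<epsilon>) B)"
      by (fact 6(3)[OF add_le[OF 6(5) less_fml(10)] 6(6,7)],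
        fact 6(4)[OF add_le[OF 6(5) less_fml(11)] 6(6,7)])
    then show ?case
      unfolding eval[OF 6(6), of "Imp A B"] step_fml(6)[OF 6(1,2)] by simp
  next
    case (7 j t A)
    have IH: "correct A" using 7(3) unfolding correct_def by blast
    show ?case
      unfolding eval[OF 7(5), of "BAll j t A"] step_fml(7)[OF 7(1,2)]
        quantifier[where P = "\<lambda>w. w \<noteq> 1", OF IH 7(1) less_fml(12-14)[OF 7(1)] 7(4-6)]
      by auto
  next
    case (8 j t A)
    have IH: "correct A" using 8(3) unfolding correct_def by blast
    show ?case
      unfolding eval[OF 8(5), of "BEx j t A"] step_fml(8)[OF 8(1,2)]
        quantifier[where P = "\<lambda>w. w = 1", OF IH 8(1) less_fml(15-17)[OF 8(1)] 8(4-6)]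
      by auto
  qed
qed

text \<open>Every variable met in the evaluation of the formula with code \<open>x\<close> has a code below
  \<open>x\<close>, hence its index is below \<open>K x\<close>. If the assigned values are at most \<open>M - 2\<close>,
  then the values of the terms with codes up to \<open>x\<close> are at most \<open>M ^ 2 ^ Suc x - 2\<close>; as there are at
  most \<open>x\<close> nested quantifiers, starting from \<open>M = a + 2\<close> all values stay below
  \<open>D x a\<close>.\<close>

lemma pr_Sat_Delta0: "primitive_recursive_rel 2 {[x, y] | x y. (x, y) \<in> Sat_Delta0 code_fml}"
proof -
  \<comment> \<open>The sum bounds the indices of all variables with codes up to \<open>x\<close>;
    summands at other numbers only enlarge it.\<close>
  define K where "K x = Suc (\<Sum>c<Suc x. index c)" for x
  \<comment> \<open>This is \<open>a + 2\<close> raised \<open>Suc x\<close> times in succession to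
    the power \<open>2 ^ Suc x\<close>, one factor for each level of
    \<open>evaluation\<close>.\<close>
  define D where "D x a = (a + 2) ^ 2 ^ (Suc x * Suc x)" for x a :: nat
  obtain W where pr_W: "primitive_recursive 4 (\<lambda>xs. W (xs ! 0) (xs ! 1) (xs ! 2) (xs ! 3))"
    and W: "\<And>D K y \<epsilon>. \<epsilon> < D ^ K \<Longrightarrow> 0 < D \<Longrightarrow> W D K y \<epsilon> = step D K (W D K) y \<epsilon> mod D"
    using evaluator by blast
  \<comment> \<open>The code of the assignment constantly \<open>a\<close> on the first
    \<open>K x\<close> variables is found by search; it exists since \<open>a < D x a\<close>.
    Without the test \<open>is_Delta0\<close>, terms of value 1 would pass.\<close>
  define S where "S x a \<longleftrightarrow> is_Delta0 x \<and> (\<exists>\<epsilon><D x a ^ K x.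
    (\<forall>i<K x. digit (D x a) \<epsilon> i = a) \<and> W (D x a) (K x) x \<epsilon> = 1)" for x a
  have S_code: "S (code_fml A) a \<longleftrightarrow> holds (\<lambda>_. a) A" if A: "Delta0 A" for A a
  proof -
    let ?x = "code_fml A"
    let ?D = "D ?x a" and ?K = "K ?x"
    define M where "M k = (a + 2) ^ 2 ^ (Suc ?x * k)" for k
    have M_Suc: "M (Suc k) = M k ^ 2 ^ Suc ?x" for k
      by (simp add: M_def power_mult[symmetric] power_add[symmetric] add.commute)
    have M_le: "M k \<le> ?D" if "k \<le> Suc ?x" for k
      unfolding M_def D_def using that by (intro power_increasing mult_le_mono) auto
    have M_0: "M 0 = a + 2" by (simp add: M_def)
    then have a_less: "a < ?D" using M_le[of 0] by simp
    have K: "i < ?K" if "code_trm (Var i) \<le> ?x" for i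
      using member_le_sum[of "code_trm (Var i)" "{..<Suc ?x}" index] that by (simp add: K_def)
    have "W ?D ?K ?x \<epsilon> = 1 \<longleftrightarrow> holds (\<lambda>_. a) A"
      if \<epsilon>: "\<epsilon> < ?D ^ ?K" "\<forall>i<?K. digit ?D \<epsilon> i = a" for \<epsilon>
    proof -
      have "digit ?D \<epsilon> i + 2 \<le> M 0" for i
        using \<epsilon> digit_eq_0[OF \<epsilon>(1), of i] a_less M_0 by (cases "i < ?K") auto
      note bound = this
      have "W ?D ?K ?x \<epsilon> = of_bool (holds (digit ?D \<epsilon>) A)"
      proof (rule evaluation[where W = "W ?D ?K" and D = ?D and K = ?K and M = M and x = ?x and k = 0])
        show "W ?D ?K y \<epsilon> = step ?D ?K (W ?D ?K) y \<epsilon> mod ?D" if "\<epsilon> < ?D ^ ?K" for y \<epsilon>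
          by (rule W[OF that]) (use a_less in simp)
      qed (simp only: add_0 order.refl | fact M_Suc M_le K A \<epsilon>(1) bound)+
      \<comment> \<open>The coded assignment is 0 from \<open>?K\<close> on, but no variable of
        \<open>A\<close> has an index that large.\<close>
      moreover have "holds (digit ?D \<epsilon>) A \<longleftrightarrow> holds (\<lambda>_. a) A"
        using \<epsilon>(2) K by (intro holds_cong[OF A]) auto
      ultimately show ?thesis by simp
    qed
    moreover have "\<exists>\<epsilon><?D ^ ?K. \<forall>i<?K. digit ?D \<epsilon> i = a"
    proof -
      obtain \<epsilon> where "\<epsilon> < ?D ^ ?K" "digit ?D \<epsilon> = (\<lambda>i. if i < ?K then a else 0)"
        by (rule ex_digits[of "\<lambda>i. if i < ?K then a else 0" ?D ?K]) (use a_less in auto)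
      then show ?thesis by (intro exI[of _ \<epsilon>]) simp
    qed
    ultimately show ?thesis unfolding S_def using A is_Delta0_code by blast
  qed
  have Sat: "(x, a) \<in> Sat_Delta0 code_fml \<longleftrightarrow> S x a" for x a
  proof -
    have "(x, a) \<in> Sat_Delta0 code_fml \<longleftrightarrow> (\<exists>A. x = code_fml A \<and> Delta0 A \<and> holds (\<lambda>_. a) A)"
      by (simp add: Sat_Delta0_def N_models_subst_num)
    also have "\<dots> \<longleftrightarrow> (\<exists>A. x = code_fml A \<and> Delta0 A \<and> S x a)"
      using S_code by blast
    also have "\<dots> \<longleftrightarrow> S x a"
      unfolding S_def is_Delta0_def by blast
    finally show ?thesis .
  qed
  have pr_K: "primitive_recursive 1 (\<lambda>xs. K (xs ! 0))"
    unfolding K_def by (intro pr_code_intros) simp_all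
  have pr_D: "primitive_recursive 2 (\<lambda>xs. D (xs ! 0) (xs ! 1))"
    unfolding D_def by (intro pr_code_intros) simp_all
  have "primitive_recursive_pred 2 (\<lambda>xs. S (xs ! 0) (xs ! 1))"
    unfolding S_def
    by (intro pr_code_intros pr_comp1[OF pr_K] pr_comp2[OF pr_D] pr_comp4[OF pr_W] pr_comp1[OF pr_is_Delta0])
      simp_all
  then show ?thesis
    unfolding primitive_recursive_rel_def
  proof (intro conjI, goal_cases)
    case 2
    then show ?case
    proof (rule pr_cong)
      fix xs :: "nat list" assume "length xs = 2"
      then obtain x a where "xs = [x, a]" by (auto simp: length_Suc_conv numeral_2_eq_2)
      then show "of_bool (S (xs ! 0) (xs ! 1)) =
          (if xs \<in> {[x, y] | x y. (x, y) \<in> Sat_Delta0 code_fml} then 1 else 0 :: nat)"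
        by (simp add: Sat)
    qed
  qed auto
qed

end

section \<open>Extracting the coding functions from an arbitrary coding\<close>

theorem theorem2p7:
  fixes code_trm :: "trm \<Rightarrow> nat" and code_fml :: "fml \<Rightarrow> nat"
  assumes "goedel_coding code_trm code_fml"
  shows "primitive_recursive_rel 2 {[x, y] | x y. (x, y) \<in> Sat_Delta0 code_fml}"
proof -
  interpret goedel_coding code_trm code_fml by fact
  \<comment> \<open>Functions on lists matter only at lists of the right length, so each may be
    replaced by one that reads its arguments individually.\<close>
  have pr1: "primitive_recursive 1 (\<lambda>xs. f [xs ! 0])" if "primitive_recursive 1 f" for f
    using that by (rule pr_cong) (auto simp: length_Suc_conv)
  have pr2: "primitive_recursive 2 (\<lambda>xs. f [xs ! 0, xs ! 1])" if "primitive_recursive 2 f" for f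
    using that by (rule pr_cong) (auto simp: length_Suc_conv numeral_2_eq_2)
  have pr3: "primitive_recursive 3 (\<lambda>xs. f [xs ! 0, xs ! 1, xs ! 2])" if "primitive_recursive 3 f" for f
    using that by (rule pr_cong) (auto simp: length_Suc_conv numeral_3_eq_3 numeral_2_eq_2)
  obtain index where index: "primitive_recursive 1 index" "\<forall>i. index [code_trm (Var i)] = i"
    using pr_var_index by blast
  obtain add mul where terms: "primitive_recursive 2 add" "primitive_recursive 2 mul"
    "\<forall>t s. code_trm (Add t s) = add [code_trm t, code_trm s]"
    "\<forall>t s. code_trm (Mul t s) = mul [code_trm t, code_trm s]"
    using pr_Add pr_Mul by blast
  obtain eq le where atoms: "primitive_recursive 2 eq" "primitive_recursive 2 le"
    "\<forall>t s. code_fml (Eq t s) = eq [code_trm t, code_trm s]"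
    "\<forall>t s. code_fml (Le t s) = le [code_trm t, code_trm s]"
    using pr_Eq pr_Le by blast
  obtain neg where neg: "primitive_recursive 1 neg" "\<forall>A. code_fml (Neg A) = neg [code_fml A]"
    using pr_Neg by blast
  obtain conj disj imp where connectives: "primitive_recursive 2 conj" "primitive_recursive 2 disj"
    "primitive_recursive 2 imp"
    "\<forall>A B. code_fml (And A B) = conj [code_fml A, code_fml B]"
    "\<forall>A B. code_fml (Or A B) = disj [code_fml A, code_fml B]"
    "\<forall>A B. code_fml (Imp A B) = imp [code_fml A, code_fml B]"
    using pr_And pr_Or pr_Imp by blast
  obtain ball bex where quantifiers: "primitive_recursive 3 ball" "primitive_recursive 3 bex"
    "\<forall>x t A. x \<notin> vars_trm t \<longrightarrow>
      code_fml (BAll x t A) = ball [code_trm (Var x), code_trm t, code_fml A]"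
    "\<forall>x t A. x \<notin> vars_trm t \<longrightarrow>
      code_fml (BEx x t A) = bex [code_trm (Var x), code_trm t, code_fml A]"
    using pr_BAll pr_BEx by blast
  have pr_is_var: "primitive_recursive_pred 1 (\<lambda>xs. \<exists>i. xs ! 0 = code_trm (Var i))"
    using conjunct2[OF pr_var_codes[unfolded primitive_recursive_rel_def]]
  proof (rule pr_cong)
    fix xs :: "nat list" assume "length xs = 1"
    then obtain c where "xs = [c]" by (auto simp: length_Suc_conv)
    then show "(if xs \<in> {[code_trm (Var i)] | i. True} then 1 else 0) =
        (of_bool (\<exists>i. xs ! 0 = code_trm (Var i)) :: nat)"
      by simp
  qed
  interpret primitive_recursive_coding code_trm code_fml "\<lambda>y. \<exists>i. y = code_trm (Var i)"
    "\<lambda>y. index [y]" "\<lambda>t s. add [t, s]" "\<lambda>t s. mul [t, s]" "\<lambda>t s. eq [t, s]" "\<lambda>t s. le [t, s]"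
    "\<lambda>A B. conj [A, B]" "\<lambda>A B. disj [A, B]" "\<lambda>A B. imp [A, B]" "\<lambda>A. neg [A]"
    "\<lambda>x t A. ball [x, t, A]" "\<lambda>x t A. bex [x, t, A]"
    by (rule primitive_recursive_coding.intro)
      (fact inj_code less_Add less_Mul less_Eq less_Le less_Neg less_And less_Or less_Imp
          less_BAll less_BEx refl pr_is_var index(1)[THEN pr1] neg(1)[THEN pr1]
          terms(1,2)[THEN pr2] atoms(1,2)[THEN pr2] connectives(1,2,3)[THEN pr2]
          quantifiers(1,2)[THEN pr3] index(2)[rule_format] terms(3,4)[rule_format]
          atoms(3,4)[rule_format] neg(2)[rule_format] connectives(4,5,6)[rule_format]
          quantifiers(3,4)[rule_format])+
  show ?thesis by (rule pr_Sat_Delta0)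
qed

end
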